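(* Assume that $A,B\in\mathrm{SL}(2,\mathbb{R})$ are hyperbolic matrices such that $C(A,B)$ is well-defined and satisfies $C(A,B)>1$. If \[ \max\left\{\tfrac{1}{2}\lvert \mathrm{tr}(A)\rvert,\ \tfrac{1}{2}\lvert \mathrm{tr}(B)\rvert\right\}\leq \frac{5\,C(A,B)-1}{3\,C(A,B)+1}, \] then the semigroup, under matrix multiplication, generated by $\{A,B\}$ is either a discrete subgroup of $\mathrm{SL}(2,\mathbb{R})$, or dense in $\mathrm{SL}(2,\mathbb{R})$.
   Context: $\mathrm{SL}(2,\mathbb{R})$ is equipped with an operator norm and the induced topology. The semigroup generated by $\{A,B\}$ is the set of all finite non-empty products of the matrices $A,B$. A non-identity matrix $A\in\mathrm{SL}(2,\mathbb{R})$ is hyperbolic if $\lvert\mathrm{tr}(A)\rvert>2$. A hyperbolic matrix has two eigenvalues $\lvert\lambda_u(A)\rvert>\lvert\lambda_s(A)\rvert$, with distinct corresponding eigenvectors $u(A),s(A)\in\mathbb{R}\mathbb{P}^1$ (respectively). $\mathbb{R}\mathbb{P}^1$ is identified with $\mathbb{R}\cup\{\infty\}$ (the line spanned by $(x,y)^T$ corresponds to $x/y$), so that $\begin{pmatrix}a&b\\c&d\end{pmatrix}$ acts by $x\mapsto\frac{ax+b}{cx+d}$. For hyperbolic $A,B\in\mathrm{SL}(2,\mathbb{R})$ the cross-ratio is \[ C(A,B)=\frac{u(A)-u(B)}{u(A)-s(B)}\cdot\frac{s(A)-s(B)}{s(A)-u(B)}, \] with the standard conventions at infinity (if one of the points is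 $\infty$, the differences containing it are omitted; $C(A,B)=0$ if $u(A)=u(B)$ or $s(A)=s(B)$ and the cross-ratio is well-defined). It is well-defined exactly when $u(A)\neq s(B)$ and $u(B)\neq s(A)$. *)

theory Defs
  imports "HOL-Analysis.Analysis" "HOL-Algebra.Group"
begin

definition SL2 :: "(real^2^2) monoid" where
  "SL2 = \<lparr>carrier = {A. det A = 1}, mult = (**), one = mat 1\<rparr>"

(* The topology used on SL(2,R) is the subspace topology of the library topology on real^2^2,
   which is given by the entrywise Euclidean norm.  It is the topology induced by the
   operator norm: *)

lemma norm_equiv_onorm:
  fixes A :: "real^2^2"
  shows "onorm ((*v) A) \<le> 4 * norm A" "norm A \<le> 4 * onorm ((*v) A)"
proof -
  have "\<bar>A $ i $ j\<bar> \<le> norm A" for i j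
    using component_le_norm_cart[of "A $ i" j] Finite_Cartesian_Product.norm_nth_le[of A i] by simp
  then show "onorm ((*v) A) \<le> 4 * norm A"
    using onorm_le_matrix_component[of A "norm A"] by simp
  have "norm A \<le> (\<Sum>i\<in>UNIV. norm (A $ i))"
    by (simp add: norm_vec_def L2_set_le_sum)
  also have "\<dots> \<le> (\<Sum>i\<in>UNIV. \<Sum>j\<in>UNIV. \<bar>A $ i $ j\<bar>)"
    by (intro sum_mono norm_le_l1_cart)
  also have "\<dots> \<le> (\<Sum>i\<in>(UNIV::2 set). \<Sum>j\<in>(UNIV::2 set). onorm ((*v) A))"
    by (intro sum_mono matrix_component_le_onorm)
  finally show "norm A \<le> 4 * onorm ((*v) A)" by simp
qed

definition hyperbolic :: "real^2^2 \<Rightarrow> bool" where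
  "hyperbolic A \<longleftrightarrow> A \<in> carrier SL2 \<and> A \<noteq> mat 1 \<and> \<bar>trace A\<bar> > 2"

definition eigenvector :: "real^2^2 \<Rightarrow> real \<Rightarrow> real^2 \<Rightarrow> bool" where
  "eigenvector A l v \<longleftrightarrow> v \<noteq> 0 \<and> A *v v = l *s v"

definition eigenvalue :: "real^2^2 \<Rightarrow> real \<Rightarrow> bool" where
  "eigenvalue A l \<longleftrightarrow> (\<exists>v. eigenvector A l v)"

(* The descriptions THE below are meaningful for hyperbolic matrices only,
   see hyperbolic_eigenvalues and hyperbolic_eigenlines. *)

definition lambda_u :: "real^2^2 \<Rightarrow> real" where
  "lambda_u A = (THE l. eigenvalue A l \<and> (\<exists>m. eigenvalue A m \<and> \<bar>m\<bar> < \<bar>l\<bar>))"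

definition lambda_s :: "real^2^2 \<Rightarrow> real" where
  "lambda_s A = (THE l. eigenvalue A l \<and> (\<exists>m. eigenvalue A m \<and> \<bar>l\<bar> < \<bar>m\<bar>))"

(* The real projective line as the union of the reals and a point at infinity. *)
datatype rp1 = Fin real | Infty

(* The point of the projective line given by the line spanned by a nonzero vector (x,y). *)
definition line_pt :: "real^2 \<Rightarrow> rp1" where
  "line_pt v = (if v $ 2 = 0 then Infty else Fin (v $ 1 / v $ 2))"

definition u_pt :: "real^2^2 \<Rightarrow> rp1" where
  "u_pt A = (THE p. \<exists>v. eigenvector A (lambda_u A) v \<and> p = line_pt v)"

definition s_pt :: "real^2^2 \<Rightarrow> rp1" where
  "s_pt A = (THE p. \<exists>v. eigenvector A (lambda_s A) v \<and> p = line_pt v)"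

(* A difference in which the point at infinity occurs is omitted, i.e. replaced by the factor 1. *)
fun rp1_diff :: "rp1 \<Rightarrow> rp1 \<Rightarrow> real" where
  "rp1_diff (Fin x) (Fin y) = x - y"
| "rp1_diff _ _ = 1"

definition cross_ratio_defined :: "real^2^2 \<Rightarrow> real^2^2 \<Rightarrow> bool" where
  "cross_ratio_defined A B \<longleftrightarrow> u_pt A \<noteq> s_pt B \<and> u_pt B \<noteq> s_pt A"

(* The first case matters only if the coinciding points are at infinity:
   there both differences would be omitted, although the cross-ratio is 0. *)
definition cross_ratio :: "real^2^2 \<Rightarrow> real^2^2 \<Rightarrow> real" where
  "cross_ratio A B =
     (if u_pt A = u_pt B \<or> s_pt A = s_pt B then 0
      else rp1_diff (u_pt A) (u_pt B) / rp1_diff (u_pt A) (s_pt B) *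
           (rp1_diff (s_pt A) (s_pt B) / rp1_diff (s_pt A) (u_pt B)))"

definition generated_semigroup :: "(real^2^2) set \<Rightarrow> (real^2^2) set" where
  "generated_semigroup X = {foldr (**) Ms (mat 1) | Ms. Ms \<noteq> [] \<and> set Ms \<subseteq> X}"

lemma eigenvector_iff:
  "eigenvector A l v \<longleftrightarrow> (v $ 1 \<noteq> 0 \<or> v $ 2 \<noteq> 0) \<and>
     A$1$1 * v$1 + A$1$2 * v$2 = l * v$1 \<and> A$2$1 * v$1 + A$2$2 * v$2 = l * v$2"
  by (auto simp: eigenvector_def vec_eq_iff forall_2 matrix_vector_mult_def sum_2)

lemma eigenvalue_iff:
  assumes "det A = 1"
  shows "eigenvalue A l \<longleftrightarrow> l * l - trace A * l + 1 = 0"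
proof -
  have d: "A$1$1 * A$2$2 - A$1$2 * A$2$1 = 1" using assms by (simp add: det_2)
  have t: "trace A = A$1$1 + A$2$2" by (simp add: trace_def sum_2)
  show ?thesis
  proof
    assume "eigenvalue A l"
    then obtain v :: "real^2" where v: "v $ 1 \<noteq> 0 \<or> v $ 2 \<noteq> 0"
      "A$1$1 * v$1 + A$1$2 * v$2 = l * v$1" "A$2$1 * v$1 + A$2$2 * v$2 = l * v$2"
      unfolding eigenvalue_def eigenvector_iff by blast
    have "(l * l - trace A * l + 1) * v$1 = 0" "(l * l - trace A * l + 1) * v$2 = 0"
      unfolding t using v(2,3) d by algebra+
    then show "l * l - trace A * l + 1 = 0" using v(1) by auto
  next
    assume l: "l * l - trace A * l + 1 = 0"
    then have p: "(A$1$1 - l) * (A$2$2 - l) = A$1$2 * A$2$1"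
      unfolding t using d by algebra
    consider "A$1$2 \<noteq> 0 \<or> A$1$1 \<noteq> l" | "A$2$1 \<noteq> 0 \<or> A$2$2 \<noteq> l"
      | "A$1$2 = 0" "A$1$1 = l" "A$2$1 = 0" "A$2$2 = l" by blast
    then show "eigenvalue A l"
    proof cases
      case 1
      then have "eigenvector A l (vector [- A$1$2, A$1$1 - l])"
        using p by (simp add: eigenvector_iff algebra_simps)
      then show ?thesis unfolding eigenvalue_def by blast
    next
      case 2
      then have "eigenvector A l (vector [A$2$2 - l, - A$2$1])"
        using p by (auto simp: eigenvector_iff algebra_simps)
      then show ?thesis unfolding eigenvalue_def by blast
    next
      case 3
      then have "eigenvector A l (vector [1, 0])"
        by (auto simp: eigenvector_iff)
      then show ?thesis unfolding eigenvalue_def by blast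
    qed
  qed
qed

lemma hyperbolic_eigenvalues:
  assumes "hyperbolic A"
  shows "eigenvalue A l \<longleftrightarrow> l = lambda_u A \<or> l = lambda_s A"
    and "\<bar>lambda_s A\<bar> < \<bar>lambda_u A\<bar>"
proof -
  define t where "t = trace A"
  have det: "det A = 1" and t2: "\<bar>t\<bar> > 2"
    using assms by (auto simp: hyperbolic_def SL2_def t_def)
  define q where "q = sqrt (t * t - 4)"
  have "\<bar>t\<bar> * \<bar>t\<bar> > 2 * 2" using t2 by (intro mult_strict_mono) auto
  then have "t * t > 4" by simp
  then have q: "q > 0" "q * q = t * t - 4" by (auto simp: q_def)
  have ev: "eigenvalue A l \<longleftrightarrow> l = (t + q) / 2 \<or> l = (t - q) / 2" for l
  proof -
    have "l * l - t * l + 1 = (l - (t + q) / 2) * (l - (t - q) / 2)"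
      using q(2) by (simp add: field_simps)
    then show ?thesis by (simp add: eigenvalue_iff[OF det] t_def[symmetric])
  qed
  have "\<bar>(t + q) / 2\<bar> \<noteq> \<bar>(t - q) / 2\<bar>" unfolding abs_eq_iff using q(1) t2 by (auto simp: field_simps)
  then obtain a b where ab: "\<bar>b\<bar> < \<bar>a\<bar>" "\<And>l. eigenvalue A l \<longleftrightarrow> l = a \<or> l = b"
  proof (cases "\<bar>(t + q) / 2\<bar>" "\<bar>(t - q) / 2\<bar>" rule: linorder_cases)
    case less
    then show thesis using that[OF less] ev by blast
  next
    case greater
    then show thesis using that[OF greater] ev by blast
  qed simp
  have "lambda_u A = a"
    unfolding lambda_u_def by (rule the_equality) (use ab in auto)
  moreover have "lambda_s A = b"
    unfolding lambda_s_def by (rule the_equality) (use ab in auto)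
  ultimately show "eigenvalue A l \<longleftrightarrow> l = lambda_u A \<or> l = lambda_s A"
    "\<bar>lambda_s A\<bar> < \<bar>lambda_u A\<bar>" using ab by auto
qed

lemma hyperbolic_eigenlines:
  assumes "hyperbolic A"
  shows "eigenvector A (lambda_u A) v \<Longrightarrow> u_pt A = line_pt v"
    and "eigenvector A (lambda_s A) v \<Longrightarrow> s_pt A = line_pt v"
    and "u_pt A \<noteq> s_pt A"
proof -
  have ne: "lambda_u A \<noteq> lambda_s A" using hyperbolic_eigenvalues(2)[OF assms] by auto
  have t: "trace A = A$1$1 + A$2$2" by (simp add: trace_def sum_2)
  have par: "line_pt v = line_pt w \<longleftrightarrow> v$1 * w$2 = v$2 * w$1"
    if "eigenvector A l v" "eigenvector A m w" for l m v w
  proof -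
    have "v$1 \<noteq> 0 \<or> v$2 \<noteq> 0" "w$1 \<noteq> 0 \<or> w$2 \<noteq> 0"
      using that by (auto simp: eigenvector_iff)
    then show ?thesis by (cases "v$2 = 0"; cases "w$2 = 0") (simp_all add: line_pt_def frac_eq_eq mult.commute)
  qed
  have same: "line_pt v = line_pt w" if "eigenvector A l v" "eigenvector A l w"
    "l = lambda_u A \<or> l = lambda_s A" for l v w
  proof (rule ccontr)
    assume "\<not> ?thesis"
    then have n: "v$1 * w$2 - v$2 * w$1 \<noteq> 0" using par that by auto
    have e: "A$1$1 * v$1 + A$1$2 * v$2 = l * v$1" "A$2$1 * v$1 + A$2$2 * v$2 = l * v$2"
      "A$1$1 * w$1 + A$1$2 * w$2 = l * w$1" "A$2$1 * w$1 + A$2$2 * w$2 = l * w$2"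
      using that by (auto simp: eigenvector_iff)
    have "(v$1 * w$2 - v$2 * w$1) * (A$1$1 - l) = 0" using e(1,3) by algebra
    moreover have "(v$1 * w$2 - v$2 * w$1) * (A$1$2) = 0" using e(1,3) by algebra
    moreover have "(v$1 * w$2 - v$2 * w$1) * (A$2$2 - l) = 0" using e(2,4) by algebra
    moreover have "(v$1 * w$2 - v$2 * w$1) * (A$2$1) = 0" using e(2,4) by algebra
    ultimately have A: "A$1$1 = l" "A$2$2 = l" "A$1$2 = 0" "A$2$1 = 0" using n by auto
    have "m = l" if "eigenvalue A m" for m
      using that A by (auto simp: eigenvalue_def eigenvector_iff)
    then show False using hyperbolic_eigenvalues(1)[OF assms] ne by metis
  qed
  show u: "u_pt A = line_pt v" if "eigenvector A (lambda_u A) v" for v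
    unfolding u_pt_def
  proof (rule the_equality)
    show "\<exists>w. eigenvector A (lambda_u A) w \<and> line_pt v = line_pt w" using that by blast
  next
    fix p assume "\<exists>w. eigenvector A (lambda_u A) w \<and> p = line_pt w"
    then obtain w where "eigenvector A (lambda_u A) w" "p = line_pt w" by blast
    then show "p = line_pt v" using same[of "lambda_u A" w v] that by simp
  qed
  show s: "s_pt A = line_pt v" if "eigenvector A (lambda_s A) v" for v
    unfolding s_pt_def
  proof (rule the_equality)
    show "\<exists>w. eigenvector A (lambda_s A) w \<and> line_pt v = line_pt w" using that by blast
  next
    fix p assume "\<exists>w. eigenvector A (lambda_s A) w \<and> p = line_pt w"
    then obtain w where "eigenvector A (lambda_s A) w" "p = line_pt w" by blast
    then show "p = line_pt v" using same[of "lambda_s A" w v] that by simp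
  qed
  obtain v w where vw: "eigenvector A (lambda_u A) v" "eigenvector A (lambda_s A) w"
    using hyperbolic_eigenvalues(1)[OF assms] unfolding eigenvalue_def by blast
  have "line_pt v \<noteq> line_pt w"
  proof
    assume "line_pt v = line_pt w"
    then have p: "v$1 * w$2 = v$2 * w$1" using par vw by blast
    have e: "A$1$1 * v$1 + A$1$2 * v$2 = lambda_u A * v$1" "A$2$1 * v$1 + A$2$2 * v$2 = lambda_u A * v$2"
      "A$1$1 * w$1 + A$1$2 * w$2 = lambda_s A * w$1" "A$2$1 * w$1 + A$2$2 * w$2 = lambda_s A * w$2"
      using vw by (auto simp: eigenvector_iff)
    have "(lambda_u A - lambda_s A) * (v$1 * w$1) = 0" using e(1,3) p by algebra
    moreover have "(lambda_u A - lambda_s A) * (v$2 * w$2) = 0" using e(2,4) p by algebra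
    ultimately have "v$1 * w$1 = 0" "v$2 * w$2 = 0" using ne by auto
    then show False using p vw by (auto simp: eigenvector_iff)
  qed
  then show "u_pt A \<noteq> s_pt A" using u[OF vw(1)] s[OF vw(2)] by simp
qed

end

theory Submission
  imports Defs
begin

text \<open>
  Write \<open>x\<close>, \<open>y\<close>, \<open>z\<close> for the half traces of \<open>A\<close>, \<open>B\<close>, \<open>A ** B\<close>, with the signs of \<open>A\<close> and \<open>B\<close> changed
  so that \<open>x\<close> and \<open>y\<close> exceed 1, and let \<open>S\<close> be the semigroup. In terms of the cross-ratio \<open>C\<close>,
  \<open>z = x * y - (C + 1) / (C - 1) * sqrt (x\<^sup>2 - 1) * sqrt (y\<^sup>2 - 1)\<close>. For \<open>C > 1\<close> this gives
  \<open>z < x * y\<close> (the two axes are disjoint and point in opposite directions) and makes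
  \<open>D = x\<^sup>2 + y\<^sup>2 + z\<^sup>2 - 2 * x * y * z - 1\<close> positive. The bound on the traces gives \<open>z > -1\<close> and \<open>x, y < 3\<close>
  (\<open>trace_data\<close>).

  A Euclidean algorithm now finds an elliptic element. If \<open>z < 1\<close>, then \<open>A ** B\<close> is elliptic.
  Otherwise \<open>D > 0\<close> forces the largest of \<open>x\<close>, \<open>y\<close>, \<open>z\<close> to exceed the product of the other
  two, so it is \<open>x\<close> or \<open>y\<close>, say \<open>x\<close>. Replace \<open>(A, B)\<close> by \<open>(A ** B, B)\<close>: the number \<open>D\<close> does not
  change, the new product has half trace \<open>2 * y * z - x > -1\<close>, and the largest half trace of a
  generator drops by at least \<open>sqrt D\<close>. So the algorithm stops
  (\<open>elliptic_product_descent\<close>) with elements \<open>A'\<close>, \<open>B'\<close> of \<open>S\<close> whose product \<open>R\<close> is elliptic. It also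
  yields that \<open>A\<close> and \<open>B\<close> are invertible in \<open>S\<close> as soon as \<open>A'\<close> and \<open>B'\<close> are.

  If \<open>R\<close> has infinite order, its powers are dense in a circle group, which lies in the closure of
  \<open>S\<close>; a circle group and a hyperbolic matrix generate the whole of SL(2,R) as a semigroup
  (\<open>rotations_and_hyperbolic_generate\<close>). If \<open>R\<close> has finite order, then \<open>R = A' ** B'\<close> is invertible in
  \<open>S\<close>, hence so are \<open>A'\<close>, \<open>B'\<close>, and \<open>S\<close> is a group. Suppose that this group is not discrete, so it
  contains \<open>g n \<noteq> 1\<close> tending to 1. For some conjugate \<open>h\<close> of \<open>R\<close> the elliptic elements \<open>h ** g n\<close>
  have, for infinitely many \<open>n\<close>, an angle close to but different from that of \<open>h\<close>. Their \<open>N\<close>-th powers,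
  \<open>N\<close> being the order of \<open>h\<close>, are rotations by arbitrarily small nonzero angles whose centres
  converge, so the closure of \<open>S\<close> again contains a circle group
  (\<open>nondiscrete_group_contains_circle\<close>).
\<close>

section \<open>Two by two matrices\<close>

lemma mat2_eq_iff:
  fixes A B :: "'a^2^2"
  shows "A = B \<longleftrightarrow> A$1$1 = B$1$1 \<and> A$1$2 = B$1$2 \<and> A$2$1 = B$2$1 \<and> A$2$2 = B$2$2"
  by (auto simp: vec_eq_iff forall_2)

lemma mat2_mult_nth:
  fixes A B :: "real^2^2"
  shows "(A ** B) $ i $ j = A$i$1 * B$1$j + A$i$2 * B$2$j"
  by (simp add: matrix_matrix_mult_def sum_2)

lemma trace2: "trace (A :: real^2^2) = A$1$1 + A$2$2"
  by (simp add: trace_def sum_2)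

lemma mat1_nth [simp]:
  "(mat 1 :: real^2^2)$1$1 = 1" "(mat 1 :: real^2^2)$1$2 = 0"
  "(mat 1 :: real^2^2)$2$1 = 0" "(mat 1 :: real^2^2)$2$2 = 1"
  by (simp_all add: mat_def)

lemmas mat2_simps = mat2_eq_iff mat2_mult_nth trace2 det_2

text \<open>The adjugate, used as the inverse on SL(2,R) because its entries are explicit.\<close>
definition adj2 :: "real^2^2 \<Rightarrow> real^2^2" where
  "adj2 A = trace A *\<^sub>R mat 1 - A"

lemma adj2_nth [simp]:
  "adj2 A $1$1 = A$2$2" "adj2 A $1$2 = - A$1$2" "adj2 A $2$1 = - A$2$1" "adj2 A $2$2 = A$1$1"
  by (simp_all add: adj2_def trace2)

lemma adj2_mult: "adj2 (A ** B) = adj2 B ** adj2 A"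
  by (simp add: mat2_simps algebra_simps)

lemma adj2_adj2 [simp]: "adj2 (adj2 A) = A"
  by (simp add: mat2_simps)

lemma det_adj2 [simp]: "det (adj2 A) = det A"
  by (simp add: mat2_simps algebra_simps)

lemma adj2_inverse:
  assumes "det A = 1"
  shows "A ** adj2 A = mat 1" "adj2 A ** A = mat 1"
  using assms by (simp_all add: mat2_simps algebra_simps)

section \<open>The cross-ratio as a relation between traces\<close>

text \<open>Homogeneous differences of points of the projective line are determinants of spanning vectors.\<close>
definition bracket :: "real^2 \<Rightarrow> real^2 \<Rightarrow> real" where
  "bracket v w = v$1 * w$2 - v$2 * w$1"

lemma line_pt_eq_iff:
  assumes "v \<noteq> 0" "w \<noteq> 0"
  shows "line_pt v = line_pt w \<longleftrightarrow> bracket v w = 0"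
proof -
  have "v$1 \<noteq> 0 \<or> v$2 \<noteq> 0" "w$1 \<noteq> 0 \<or> w$2 \<noteq> 0"
    using assms by (auto simp: vec_eq_iff forall_2)
  then show ?thesis
    by (cases "v$2 = 0"; cases "w$2 = 0")
      (auto simp: line_pt_def bracket_def frac_eq_eq mult.commute)
qed

text \<open>
  The convention for differences that involve the point at infinity amounts to a rescaling of the
  homogeneous difference. The scaling factor of the second point differs from that of the first by
  a sign at infinity. All factors cancel in the cross-ratio: each of the four points occurs once
  above and once below the fraction bar, both times on the same side of the difference.
\<close>
lemma rp1_diff_bracket:
  obtains c d :: "real^2 \<Rightarrow> real" where "\<And>v. v \<noteq> 0 \<Longrightarrow> c v \<noteq> 0" "\<And>v. v \<noteq> 0 \<Longrightarrow> d v \<noteq> 0"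
    "\<And>v w. v \<noteq> 0 \<Longrightarrow> w \<noteq> 0 \<Longrightarrow> line_pt v \<noteq> line_pt w \<Longrightarrow>
       rp1_diff (line_pt v) (line_pt w) = bracket v w * (c v * d w)"
proof
  let ?c = "\<lambda>v::real^2. if v$2 = 0 then 1 / v$1 else 1 / v$2"
  let ?d = "\<lambda>v::real^2. if v$2 = 0 then - 1 / v$1 else 1 / v$2"
  show "?c v \<noteq> 0" "?d v \<noteq> 0" if "v \<noteq> 0" for v
    using that by (auto simp: vec_eq_iff forall_2)
  show "rp1_diff (line_pt v) (line_pt w) = bracket v w * (?c v * ?d w)"
    if "v \<noteq> 0" "w \<noteq> 0" "line_pt v \<noteq> line_pt w" for v w
    using that by (auto simp: line_pt_def bracket_def vec_eq_iff forall_2 field_simps)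
qed

lemma cross_ratio_bracket:
  assumes ne: "v \<noteq> 0" "w \<noteq> 0" "v' \<noteq> 0" "w' \<noteq> 0"
    and pts: "u_pt A = line_pt v" "s_pt A = line_pt w" "u_pt B = line_pt v'" "s_pt B = line_pt w'"
    and "u_pt A \<noteq> s_pt A" "u_pt B \<noteq> s_pt B"
    and "cross_ratio_defined A B" "cross_ratio A B \<noteq> 0"
  shows "bracket v w' * bracket w v' \<noteq> 0"
    and "cross_ratio A B * (bracket v w' * bracket w v') = bracket v v' * bracket w w'"
proof -
  have u: "line_pt v \<noteq> line_pt v'" and s: "line_pt w \<noteq> line_pt w'"
    using assms(12) pts by (auto simp: cross_ratio_def split: if_splits)
  have us: "line_pt v \<noteq> line_pt w'" "line_pt v' \<noteq> line_pt w" "line_pt v \<noteq> line_pt w" "line_pt v' \<noteq> line_pt w'"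
    using assms(9-11) pts by (auto simp: cross_ratio_defined_def)
  have n: "bracket v w' \<noteq> 0" "bracket v' w \<noteq> 0"
    using us ne by (auto simp: line_pt_eq_iff)
  have swap: "bracket w v' = - bracket v' w" by (simp add: bracket_def)
  with n show nz: "bracket v w' * bracket w v' \<noteq> 0" by (simp add: swap)
  have "cross_ratio A B = bracket v v' * bracket w w' / (bracket v w' * bracket w v')"
  proof -
    obtain c d where cd: "\<And>v. v \<noteq> 0 \<Longrightarrow> c v \<noteq> (0::real)" "\<And>v. v \<noteq> 0 \<Longrightarrow> d v \<noteq> (0::real)"
      "\<And>v w. v \<noteq> 0 \<Longrightarrow> w \<noteq> 0 \<Longrightarrow> line_pt v \<noteq> line_pt w \<Longrightarrow>
         rp1_diff (line_pt v) (line_pt w) = bracket v w * (c v * d w)"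
      using rp1_diff_bracket by metis
    have "cross_ratio A B =
        bracket v v' * (c v * d v') / (bracket v w' * (c v * d w')) *
        (bracket w w' * (c w * d w') / (bracket w v' * (c w * d v')))"
      using u s us ne by (simp add: cross_ratio_def pts cd(3) eq_commute[of "line_pt w" "line_pt v'"])
    also have "\<dots> = bracket v v' * bracket w w' / (bracket v w' * bracket w v')"
      using ne cd(1,2) by (simp add: field_simps)
    finally show ?thesis .
  qed
  then show "cross_ratio A B * (bracket v w' * bracket w v') = bracket v v' * bracket w w'"
    using nz by simp
qed

lemma hyperbolic_eigenbasis:
  assumes "hyperbolic A"
  obtains v w a where "v \<noteq> 0" "w \<noteq> 0" "u_pt A = line_pt v" "s_pt A = line_pt w"
    "bracket v w \<noteq> 0" "\<bar>a\<bar> > 1" "trace A = a + 1 / a"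
    "A *v v = a *s v" "A *v w = (1 / a) *s w"
proof -
  let ?l = "lambda_u A" and ?m = "lambda_s A"
  have det: "det A = 1" using assms by (simp add: hyperbolic_def SL2_def)
  have ev: "eigenvalue A ?l" "eigenvalue A ?m" and lt: "\<bar>?m\<bar> < \<bar>?l\<bar>"
    using hyperbolic_eigenvalues[OF assms] by auto
  have q: "?l * ?l - trace A * ?l + 1 = 0" "?m * ?m - trace A * ?m + 1 = 0"
    using ev eigenvalue_iff[OF det] by auto
  have "(?l - ?m) * (?l + ?m - trace A) = 0" using q by algebra
  then have sum: "trace A = ?l + ?m" using lt by auto
  then have prod: "?l * ?m = 1" using q(1) by algebra
  then have m: "?m = 1 / ?l" by (simp add: eq_divide_eq mult.commute) (use prod in auto)
  have abs: "\<bar>?l\<bar> > 1"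
  proof (rule ccontr)
    assume "\<not> \<bar>?l\<bar> > 1"
    moreover from this have "\<bar>?l\<bar> * \<bar>?m\<bar> \<le> 1 * \<bar>?m\<bar>" by (intro mult_right_mono) auto
    ultimately show False using lt prod by (simp add: abs_mult[symmetric])
  qed
  obtain v w where vw: "eigenvector A ?l v" "eigenvector A ?m w"
    using ev by (auto simp: eigenvalue_def)
  then have ne: "v \<noteq> 0" "w \<noteq> 0" by (auto simp: eigenvector_def)
  have pt: "u_pt A = line_pt v" "s_pt A = line_pt w"
    using hyperbolic_eigenlines[OF assms] vw by auto
  have "bracket v w \<noteq> 0"
    using hyperbolic_eigenlines(3)[OF assms] pt line_pt_eq_iff[OF ne] by simp
  then show thesis
    using that[of v w ?l] ne pt abs sum m vw by (simp add: eigenvector_def)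
qed

text \<open>Cramer's rule for the entries of a matrix with prescribed eigenvectors and eigenvalues.\<close>
lemma eigenbasis_entries:
  fixes A :: "real^2^2"
  assumes "A *v v = a *s v" "A *v w = b *s w"
  shows "bracket v w * A$1$1 = a * v$1 * w$2 - b * w$1 * v$2"
    and "bracket v w * A$1$2 = (b - a) * v$1 * w$1"
    and "bracket v w * A$2$1 = (a - b) * v$2 * w$2"
    and "bracket v w * A$2$2 = b * v$1 * w$2 - a * v$2 * w$1"
proof -
  have e: "A$1$1 * v$1 + A$1$2 * v$2 = a * v$1" "A$2$1 * v$1 + A$2$2 * v$2 = a * v$2"
    "A$1$1 * w$1 + A$1$2 * w$2 = b * w$1" "A$2$1 * w$1 + A$2$2 * w$2 = b * w$2"
    using assms by (auto simp: vec_eq_iff forall_2 matrix_vector_mult_def sum_2)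
  show "bracket v w * A$1$1 = a * v$1 * w$2 - b * w$1 * v$2"
    "bracket v w * A$1$2 = (b - a) * v$1 * w$1"
    "bracket v w * A$2$1 = (a - b) * v$2 * w$2"
    "bracket v w * A$2$2 = b * v$1 * w$2 - a * v$2 * w$1"
    unfolding bracket_def using e by algebra+
qed

text \<open>
  Both sides are polynomials in the eigenvectors after multiplication by the brackets of the two
  eigenbases. The cross-ratio enters through the Pluecker relation between the six brackets of
  four vectors.
\<close>
lemma trace_mult_cross_ratio:
  fixes A B :: "real^2^2"
  assumes A: "A *v v = a *s v" "A *v w = a' *s w"
    and B: "B *v v' = b *s v'" "B *v w' = b' *s w'"
    and nz: "bracket v w \<noteq> 0" "bracket v' w' \<noteq> 0" "bracket v w' * bracket w v' \<noteq> 0"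
    and C: "C * (bracket v w' * bracket w v') = bracket v v' * bracket w w'"
    and tr: "trace A = a + a'" "trace B = b + b'"
    and "C \<noteq> 1"
  shows "2 * trace (A ** B) = trace A * trace B - (C + 1) / (C - 1) * ((a - a') * (b - b'))"
proof -
  let ?n = "bracket v w' * bracket w v'" and ?k = "bracket v v' * bracket w w'"
  let ?m = "bracket v w * bracket v' w'"
  define K where "K = (C + 1) / (C - 1)"
  have m: "?m = ?k - ?n" by (simp add: bracket_def algebra_simps)
  note eA = eigenbasis_entries[OF A] and eB = eigenbasis_entries[OF B]
  have "?m * trace (A ** B) =
     (bracket v w * A$1$1) * (bracket v' w' * B$1$1) + (bracket v w * A$1$2) * (bracket v' w' * B$2$1)
   + (bracket v w * A$2$1) * (bracket v' w' * B$1$2) + (bracket v w * A$2$2) * (bracket v' w' * B$2$2)"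
    by (simp add: trace2 mat2_mult_nth algebra_simps)
  also have "2 * \<dots> = (a + a') * (b + b') * ?m - (?k + ?n) * ((a - a') * (b - b'))"
    unfolding eA eB by (simp add: bracket_def algebra_simps)
  finally have "2 * trace (A ** B) * ?m = trace A * trace B * ?m - (?k + ?n) * ((a - a') * (b - b'))"
    by (simp add: tr algebra_simps)
  also have "?k + ?n = K * ?m"
    using \<open>C \<noteq> 1\<close> C by (simp add: K_def m field_simps)
  finally have "(2 * trace (A ** B) - (trace A * trace B - K * ((a - a') * (b - b')))) * ?m = 0"
    by algebra
  then have "2 * trace (A ** B) - (trace A * trace B - K * ((a - a') * (b - b'))) = 0"
    using nz(1,2) unfolding mult_eq_0_iff by blast
  then show ?thesis by (simp add: K_def)
qed

text \<open>
  The bound on \<open>x\<close> is equivalent to \<open>x - 1 \<le> r * (x + 1)\<close> with \<open>r = (C - 1) / (4 * C)\<close>, so that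
  \<open>p\<^sup>2 = (x - 1) * (x + 1) \<le> r * (x + 1)\<^sup>2\<close>. Hence the term subtracted in \<open>z\<close> is at most
  \<open>(C + 1) / (4 * C) * (x + 1) * (y + 1)\<close>, less than half of \<open>(x + 1) * (y + 1)\<close>, which is at most
  \<open>x * y + 1\<close>.
\<close>
lemma half_trace_bounds:
  fixes x y p q C :: real
  assumes C: "C > 1" and xy: "x > 1" "y > 1" "x \<le> (5 * C - 1) / (3 * C + 1)" "y \<le> (5 * C - 1) / (3 * C + 1)"
    and pq: "p > 0" "q > 0" "p\<^sup>2 = x\<^sup>2 - 1" "q\<^sup>2 = y\<^sup>2 - 1"
    and z: "z = x * y - (C + 1) / (C - 1) * (p * q)"
  shows "z < x * y" "z > -1" "x\<^sup>2 + y\<^sup>2 + z\<^sup>2 - 2 * x * y * z - 1 > 0" "x < 3" "y < 3"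
proof -
  define k where "k = (C + 1) / (C - 1)"
  define r where "r = (C - 1) / (4 * C)"
  have k: "k > 1" using C by (simp add: k_def)
  have r: "r > 0" using C by (simp add: r_def)
  have "(5 * C - 1) / (3 * C + 1) < 3" using C by (simp add: field_simps)
  then show "x < 3" "y < 3" using xy by auto
  have pos: "p * q > 0" using pq by simp
  then have kpq: "k * (p * q) > 0" using k by simp
  then show "z < x * y" by (simp add: z k_def)
  have "x\<^sup>2 + y\<^sup>2 + z\<^sup>2 - 2 * x * y * z - 1 = (z - x * y)\<^sup>2 - (x\<^sup>2 - 1) * (y\<^sup>2 - 1)"
    by (simp add: power2_eq_square algebra_simps)
  also have "\<dots> = (k\<^sup>2 - 1) * (p * q)\<^sup>2"
    unfolding pq(3,4)[symmetric] by (simp add: z k_def[symmetric] power2_eq_square algebra_simps)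
  also have "\<dots> > 0" using pos k by (simp add: power2_eq_square less_1_mult)
  finally show "x\<^sup>2 + y\<^sup>2 + z\<^sup>2 - 2 * x * y * z - 1 > 0" .
  have lin: "t - 1 \<le> r * (t + 1)" if "t \<le> (5 * C - 1) / (3 * C + 1)" for t
    using that C by (simp add: r_def field_simps)
  have sq: "h\<^sup>2 \<le> r * (t + 1)\<^sup>2" if "t \<le> (5 * C - 1) / (3 * C + 1)" "t > 1" "h\<^sup>2 = t\<^sup>2 - 1" for t h
  proof -
    have "h\<^sup>2 = (t - 1) * (t + 1)" unfolding that(3) by (simp add: power2_eq_square algebra_simps)
    also have "\<dots> \<le> r * (t + 1) * (t + 1)" by (intro mult_right_mono lin) (use that in auto)
    finally show ?thesis by (simp add: power2_eq_square mult.assoc)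
  qed
  have "(p * q)\<^sup>2 \<le> (r * (x + 1)\<^sup>2) * (r * (y + 1)\<^sup>2)"
    unfolding power_mult_distrib using sq xy pq r by (intro mult_mono) auto
  also have "\<dots> = (r * ((x + 1) * (y + 1)))\<^sup>2" by (simp add: power2_eq_square algebra_simps)
  finally have "p * q \<le> r * ((x + 1) * (y + 1))"
    by (rule power2_le_imp_le) (use r xy in auto)
  then have "k * (p * q) \<le> k * (r * ((x + 1) * (y + 1)))" using k by (intro mult_left_mono) auto
  also have "\<dots> = (C + 1) / (4 * C) * ((x + 1) * (y + 1))"
    using C by (simp add: k_def r_def)
  also have "\<dots> < 1 / 2 * ((x + 1) * (y + 1))"
    using C xy by (intro mult_strict_right_mono mult_pos_pos) (auto simp: divide_less_eq)
  also have "\<dots> \<le> x * y + 1"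
  proof -
    have "(x - 1) * (y - 1) \<ge> 0" using xy by simp
    then have "x + y \<le> x * y + 1" by (simp add: algebra_simps)
    moreover have "(x + 1) * (y + 1) = x * y + x + y + 1" by (simp add: algebra_simps)
    ultimately show ?thesis by linarith
  qed
  finally show "z > -1" by (simp add: z k_def)
qed

text \<open>
  Multiplying \<open>A\<close> and \<open>B\<close> by the signs of their traces changes neither their fixed points nor
  whether a product is elliptic, so half traces are taken with these signs.
\<close>
lemma trace_data:
  assumes hA: "hyperbolic A" and hB: "hyperbolic B"
    and def: "cross_ratio_defined A B" and C: "cross_ratio A B > 1"
    and bound: "max (1/2 * \<bar>trace A\<bar>) (1/2 * \<bar>trace B\<bar>) \<le>
           (5 * cross_ratio A B - 1) / (3 * cross_ratio A B + 1)"
    and xyz: "x = sgn (trace A) * trace A / 2" "y = sgn (trace B) * trace B / 2"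
      "z = sgn (trace A) * sgn (trace B) * trace (A ** B) / 2"
  shows "x > 1" "y > 1" "z < x * y" "z > -1" "x\<^sup>2 + y\<^sup>2 + z\<^sup>2 - 2 * x * y * z - 1 > 0" "x < 3" "y < 3"
proof -
  let ?C = "cross_ratio A B"
  obtain v w a where A: "v \<noteq> 0" "w \<noteq> 0" "u_pt A = line_pt v" "s_pt A = line_pt w"
    "bracket v w \<noteq> 0" "\<bar>a\<bar> > 1" "trace A = a + 1 / a" "A *v v = a *s v" "A *v w = (1 / a) *s w"
    using hyperbolic_eigenbasis[OF hA] by metis
  obtain v' w' b where B: "v' \<noteq> 0" "w' \<noteq> 0" "u_pt B = line_pt v'" "s_pt B = line_pt w'"
    "bracket v' w' \<noteq> 0" "\<bar>b\<bar> > 1" "trace B = b + 1 / b" "B *v v' = b *s v'" "B *v w' = (1 / b) *s w'"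
    using hyperbolic_eigenbasis[OF hB] by metis
  note cr = cross_ratio_bracket[OF A(1,2) B(1,2) A(3,4) B(3,4) hyperbolic_eigenlines(3)[OF hA]
      hyperbolic_eigenlines(3)[OF hB] def]
  have tr: "2 * trace (A ** B) = trace A * trace B - (?C + 1) / (?C - 1) * ((a - 1 / a) * (b - 1 / b))"
    by (rule trace_mult_cross_ratio[OF A(8,9) B(8,9) A(5) B(5) cr A(7) B(7)]) (use C in auto)
  have gap: "sgn (c + 1 / c) * (c - 1 / c) > 0" "(sgn (c + 1 / c))\<^sup>2 = 1" if "\<bar>c\<bar> > 1" for c :: real
  proof -
    have cc: "c * c > 1" using that less_1_mult[of "\<bar>c\<bar>" "\<bar>c\<bar>"] by simp
    have "c \<noteq> 0" using that by auto
    then consider "c > 0" | "c < 0" by linarith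
    then show "sgn (c + 1 / c) * (c - 1 / c) > 0"
    proof cases
      case 1
      then have "c + 1 / c > 0" by (simp add: add_pos_pos)
      then show ?thesis using 1 cc by (simp add: field_simps)
    next
      case 2
      then have "c + 1 / c < 0" by (simp add: add_neg_neg)
      then show ?thesis using 2 cc by (simp add: field_simps)
    qed
    have "c * (c + 1 / c) > 0" using \<open>c \<noteq> 0\<close> cc by (simp add: distrib_left)
    then have "c + 1 / c \<noteq> 0" by auto
    then show "(sgn (c + 1 / c))\<^sup>2 = 1" by (simp add: sgn_real_def)
  qed
  define p where "p = sgn (trace A) * (a - 1 / a) / 2"
  define q where "q = sgn (trace B) * (b - 1 / b) / 2"
  have p: "p > 0" "(sgn (trace A))\<^sup>2 = 1" and q: "q > 0" "(sgn (trace B))\<^sup>2 = 1"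
    using gap[OF A(6)] gap[OF B(6)] by (simp_all add: p_def q_def A(7) B(7))
  have half_diff_sq: "1 * (c - 1 / c)\<^sup>2 / 2\<^sup>2 = 1 * (c + 1 / c)\<^sup>2 / 2\<^sup>2 - 1" if "c \<noteq> 0" for c :: real
    using that by (simp add: power2_eq_square divide_simps) (simp add: algebra_simps)
  have p2: "p\<^sup>2 = x\<^sup>2 - 1"
    unfolding p_def xyz power_divide power_mult_distrib p(2) unfolding A(7)
    by (rule half_diff_sq) (use A(6) in auto)
  have q2: "q\<^sup>2 = y\<^sup>2 - 1"
    unfolding q_def xyz power_divide power_mult_distrib q(2) unfolding B(7)
    by (rule half_diff_sq) (use B(6) in auto)
  have z: "z = x * y - (?C + 1) / (?C - 1) * (p * q)"
  proof -
    define K \<alpha> \<beta> where "K = (?C + 1) / (?C - 1)" and "\<alpha> = a - 1 / a" and "\<beta> = b - 1 / b"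
    have "4 * z = sgn (trace A) * sgn (trace B) * (2 * trace (A ** B))" by (simp add: xyz)
    also have "\<dots> = 4 * (x * y - (?C + 1) / (?C - 1) * (p * q))"
      unfolding tr xyz p_def q_def K_def[symmetric] \<alpha>_def[symmetric] \<beta>_def[symmetric]
      by (simp add: algebra_simps)
    finally show ?thesis by simp
  qed
  have xa: "x = 1/2 * \<bar>trace A\<bar>" "y = 1/2 * \<bar>trace B\<bar>"
    by (simp_all add: xyz abs_sgn mult.commute)
  then show xy: "x > 1" "y > 1" using hA hB by (auto simp: hyperbolic_def)
  have le: "x \<le> (5 * ?C - 1) / (3 * ?C + 1)" "y \<le> (5 * ?C - 1) / (3 * ?C + 1)"
    using bound[folded xa] by simp_all
  show "z < x * y" "z > -1" "x\<^sup>2 + y\<^sup>2 + z\<^sup>2 - 2 * x * y * z - 1 > 0" "x < 3" "y < 3"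
    using half_trace_bounds[OF C xy le p(1) q(1) p2 q2 z] by auto
qed

section \<open>A Euclidean algorithm for half traces\<close>

text \<open>
  With \<open>x = cosh a\<close>, \<open>y = cosh b\<close>, \<open>z = cosh c\<close> the hypothesis \<open>(x - y * z)\<^sup>2 > (y\<^sup>2 - 1) * (z\<^sup>2 - 1)\<close> says
  that \<open>cosh a\<close> lies outside the interval from \<open>cosh (b - c)\<close> to \<open>cosh (b + c)\<close>. As \<open>a\<close> is the
  largest of the three, it is at least \<open>\<bar>b - c\<bar>\<close>, so it lies above that interval.
\<close>
lemma largest_exceeds_product:
  fixes x y z :: real
  assumes "y \<ge> 1" "z \<ge> 1" "x \<ge> y" "x \<ge> z" "x\<^sup>2 + y\<^sup>2 + z\<^sup>2 - 2 * x * y * z - 1 > 0"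
  shows "x > y * z"
proof (rule ccontr)
  assume "\<not> x > y * z"
  then have le: "x \<le> y * z" by simp
  define s t where "s = max y z" and "t = min y z"
  have st: "1 \<le> t" "t \<le> s" "s \<le> x" "y * z = s * t" "y\<^sup>2 + z\<^sup>2 = s\<^sup>2 + t\<^sup>2"
    using assms by (auto simp: s_def t_def max_def min_def algebra_simps)
  have "x\<^sup>2 + (s\<^sup>2 + t\<^sup>2) - 2 * x * (s * t) - 1 > 0"
    using assms(5) unfolding st(4,5)[symmetric] by (simp add: algebra_simps)
  then have "(s\<^sup>2 - 1) * (t\<^sup>2 - 1) < (y * z - x)\<^sup>2"
    unfolding st(4) by (simp add: power2_eq_square algebra_simps)
  also have "(y * z - x)\<^sup>2 \<le> (s * (t - 1))\<^sup>2"
    using le st by (intro power_mono) (auto simp: algebra_simps)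
  finally have "(t - 1) * ((s\<^sup>2 - 1) * (t + 1)) < (t - 1) * (s\<^sup>2 * (t - 1))"
    by (simp add: power2_eq_square algebra_simps)
  then have "(s\<^sup>2 - 1) * (t + 1) < s\<^sup>2 * (t - 1)"
    using st(1) by (simp add: mult_less_cancel_left)
  then have "2 * s\<^sup>2 < t + 1" by (simp add: algebra_simps)
  moreover have "s * 1 \<le> s * s" using st by (intro mult_left_mono) auto
  ultimately show False using st by (simp add: power2_eq_square)
qed

text \<open>
  The algorithm explained at the top. The number \<open>c\<close> is the square root of the invariant \<open>D\<close>, and the
  induction is on a bound for the number of steps of size \<open>c\<close> from 1 up to \<open>x\<close> and \<open>y\<close>. The signs
  \<open>\<sigma>\<close> and \<open>\<tau>\<close> make the half traces positive; the sign of a product is the product of the signs.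
  The bound 3 is what keeps the half trace of the new product above -1, as
  \<open>2 * y * z - x \<ge> 2 - x\<close>.
\<close>
lemma elliptic_product_descent:
  fixes A B :: "real^2^2"
  assumes S: "\<And>X Y. X \<in> S \<Longrightarrow> Y \<in> S \<Longrightarrow> X ** Y \<in> S" "A \<in> S" "B \<in> S"
    and det: "det A = 1" "det B = 1"
    and signs: "\<sigma>\<^sup>2 = 1" "\<tau>\<^sup>2 = 1"
    and xyz: "x = \<sigma> * trace A / 2" "y = \<tau> * trace B / 2" "z = \<sigma> * \<tau> * trace (A ** B) / 2"
    and c: "c > 0" "x\<^sup>2 + y\<^sup>2 + z\<^sup>2 - 2 * x * y * z - 1 = c\<^sup>2"
    and x: "1 \<le> x" "x < 3" "x \<le> 1 + real n * c"
    and y: "1 \<le> y" "y < 3" "y \<le> 1 + real n * c"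
    and z: "-1 < z" "z < x * y"
  shows "\<exists>A'\<in>S. \<exists>B'\<in>S. \<bar>trace (A' ** B')\<bar> < 2 \<and>
           (adj2 A' \<in> S \<and> adj2 B' \<in> S \<longrightarrow> adj2 A \<in> S \<and> adj2 B \<in> S)"
  using assms
proof (induction n arbitrary: A B \<sigma> \<tau> x y z)
  case (0 A B \<sigma> \<tau> x y z)
  have "x = 1" "y = 1" using "0.prems"(13,15,16,18) by auto
  then have "\<bar>2 * z\<bar> < 2" using "0.prems"(19,20) by simp
  moreover have "\<bar>\<sigma>\<bar> = 1" "\<bar>\<tau>\<bar> = 1" using "0.prems"(6,7) by (auto simp: power2_eq_1_iff)
  ultimately have "\<bar>trace (A ** B)\<bar> < 2" by (simp add: "0.prems"(10) abs_mult)
  then show ?case using "0.prems"(2,3) by blast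
next
  case (Suc n A B \<sigma> \<tau> x y z)
  note S = Suc.prems(1-3) and det = Suc.prems(4,5) and signs = Suc.prems(6,7) and xyz = Suc.prems(8-10)
    and c = Suc.prems(11,12) and x = Suc.prems(13-15) and y = Suc.prems(16-18) and z = Suc.prems(19,20)
  have abs1: "\<bar>\<sigma>\<bar> = 1" "\<bar>\<tau>\<bar> = 1" using signs by (auto simp: power2_eq_1_iff)
  show ?case
  proof (cases "z < 1")
    case True
    moreover have "\<bar>2 * z\<bar> = \<bar>trace (A ** B)\<bar>" by (simp add: xyz abs_mult abs1)
    ultimately have "\<bar>trace (A ** B)\<bar> < 2" using z(1) by simp
    then show ?thesis using S by blast
  next
    case False
    then have z1: "z \<ge> 1" by simp
    have pos: "x\<^sup>2 + y\<^sup>2 + z\<^sup>2 - 2 * x * y * z - 1 > 0" using c by simp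
    \<comment> \<open>The two cases below use this with the larger generator \<open>r\<close> and the smaller one \<open>t\<close>.\<close>
    have drop: "z \<le> 1 + real n * c" "t \<le> 1 + real n * c" "2 * z * t - r > -1" "2 * z * t - r < z * t"
      if "r \<ge> 1" "t \<ge> 1" "r < 3" "r \<le> 1 + real (Suc n) * c" "r > t * z"
        "(r - t * z)\<^sup>2 = c\<^sup>2 + (t\<^sup>2 - 1) * (z\<^sup>2 - 1)" for r t
    proof -
      have "c\<^sup>2 \<le> (r - t * z)\<^sup>2" using that z1 by simp
      then have "c \<le> r - t * z" by (rule power2_le_imp_le) (use that in auto)
      moreover have "z \<le> t * z" "t \<le> t * z"
        using that z1 mult_right_mono[of 1 t z] mult_left_mono[of 1 z t] by auto
      moreover have "1 + real (Suc n) * c = 1 + real n * c + c" "2 * z * t = 2 * (t * z)" "z * t = t * z"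
        by (simp_all add: algebra_simps)
      ultimately show "z \<le> 1 + real n * c" "t \<le> 1 + real n * c" "2 * z * t - r > -1" "2 * z * t - r < z * t"
        using that z1 by linarith+
    qed
    consider "x \<ge> y" "x \<ge> z" | "y \<ge> x" "y \<ge> z" | "z \<ge> x" "z \<ge> y" by linarith
    then show ?thesis
    proof cases
      case 1
      have "x > y * z" using largest_exceeds_product[OF y(1) z1 1 pos] .
      note d = drop[OF x(1) y(1) x(2,3) this]
      have "\<exists>A'\<in>S. \<exists>B'\<in>S. \<bar>trace (A' ** B')\<bar> < 2 \<and>
           (adj2 A' \<in> S \<and> adj2 B' \<in> S \<longrightarrow> adj2 (A ** B) \<in> S \<and> adj2 B \<in> S)"
      proof (rule Suc.IH[where \<sigma> = "\<sigma> * \<tau>" and \<tau> = \<tau>])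
        have "trace (A ** B ** B) = trace (A ** B) * trace B - trace A"
          using det(2) by (simp add: mat2_simps) algebra
        then show "2 * z * y - x = \<sigma> * \<tau> * \<tau> * trace (A ** B ** B) / 2"
          unfolding xyz using signs by (simp add: algebra_simps power2_eq_square) algebra
        show "z\<^sup>2 + y\<^sup>2 + (2 * z * y - x)\<^sup>2 - 2 * z * y * (2 * z * y - x) - 1 = c\<^sup>2"
          using c(2) by algebra
        show "(\<sigma> * \<tau>)\<^sup>2 = 1" using signs by (simp add: power_mult_distrib)
        show "z < 3" "z \<le> 1 + real n * c" "y \<le> 1 + real n * c" "- 1 < 2 * z * y - x" "2 * z * y - x < z * y"
          using d c(2) 1 x by (auto simp: power2_eq_square algebra_simps)
      qed (use S det signs xyz c x y z1 in \<open>auto simp: det_mul\<close>)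
      moreover have "adj2 A \<in> S" if "adj2 (A ** B) \<in> S" "adj2 B \<in> S"
      proof -
        have "B ** adj2 (A ** B) = adj2 A"
          by (simp add: adj2_mult matrix_mul_assoc adj2_inverse[OF det(2)])
        then show ?thesis using S(1)[OF S(3) that(1)] by simp
      qed
      ultimately show ?thesis by blast
    next
      case 2
      have "y > x * z" using largest_exceeds_product[OF x(1) z1 2] pos by (simp add: algebra_simps)
      note d = drop[OF y(1) x(1) y(2,3) this]
      have "\<exists>A'\<in>S. \<exists>B'\<in>S. \<bar>trace (A' ** B')\<bar> < 2 \<and>
           (adj2 A' \<in> S \<and> adj2 B' \<in> S \<longrightarrow> adj2 A \<in> S \<and> adj2 (A ** B) \<in> S)"
      proof (rule Suc.IH[where \<sigma> = \<sigma> and \<tau> = "\<sigma> * \<tau>"])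
        have "trace (A ** (A ** B)) = trace A * trace (A ** B) - trace B"
          using det(1) by (simp add: mat2_simps) algebra
        then show "2 * z * x - y = \<sigma> * (\<sigma> * \<tau>) * trace (A ** (A ** B)) / 2"
          unfolding xyz using signs by (simp add: algebra_simps power2_eq_square) algebra
        show "x\<^sup>2 + z\<^sup>2 + (2 * z * x - y)\<^sup>2 - 2 * x * z * (2 * z * x - y) - 1 = c\<^sup>2"
          using c(2) by algebra
        show "(\<sigma> * \<tau>)\<^sup>2 = 1" using signs by (simp add: power_mult_distrib)
        show "z < 3" "z \<le> 1 + real n * c" "x \<le> 1 + real n * c" "- 1 < 2 * z * x - y" "2 * z * x - y < x * z"
          using d c(2) 2 y by (auto simp: power2_eq_square algebra_simps)
      qed (use S det signs xyz c x y z1 in \<open>auto simp: det_mul\<close>)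
      moreover have "adj2 B \<in> S" if "adj2 (A ** B) \<in> S" "adj2 A \<in> S"
      proof -
        have "adj2 (A ** B) ** A = adj2 B"
          by (simp add: adj2_mult adj2_inverse[OF det(1)] flip: matrix_mul_assoc)
        then show ?thesis using S(1)[OF that(1) S(2)] by simp
      qed
      ultimately show ?thesis by blast
    next
      case 3
      have "z > x * y" using largest_exceeds_product[OF x(1) y(1) 3] pos by (simp add: algebra_simps)
      then show ?thesis using z(2) by simp
    qed
  qed
qed

section \<open>Elliptic matrices as rotations\<close>

text \<open>For \<open>J ** J = - 1\<close>, these matrices form the circle group that fixes the fixed point of \<open>J\<close> in the upper half plane.\<close>
definition rotation :: "real^2^2 \<Rightarrow> real \<Rightarrow> real^2^2" where
  "rotation J \<phi> = cos \<phi> *\<^sub>R mat 1 + sin \<phi> *\<^sub>R J"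

lemma rotation_add:
  assumes "J ** J = - mat 1"
  shows "rotation J \<phi> ** rotation J \<psi> = rotation J (\<phi> + \<psi>)"
proof -
  have e: "J$1$1 * J$1$1 + J$1$2 * J$2$1 = -1" "J$1$1 * J$1$2 + J$1$2 * J$2$2 = 0"
    "J$2$1 * J$1$1 + J$2$2 * J$2$1 = 0" "J$2$1 * J$1$2 + J$2$2 * J$2$2 = -1"
    using assms by (auto simp: mat2_simps)
  show ?thesis
    unfolding mat2_eq_iff mat2_mult_nth rotation_def cos_add sin_add
    by (simp; intro conjI; use e in algebra)
qed

lemma rotation_periodic:
  assumes "sin \<phi> = sin \<psi>" "cos \<phi> = cos \<psi>"
  shows "rotation J \<phi> = rotation J \<psi>"
  using assms by (simp add: rotation_def)

lemma rotation_plus_2pi: "rotation J (\<phi> + 2 * pi * of_int m) = rotation J \<phi>"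
proof (rule rotation_periodic)
  show "sin (\<phi> + 2 * pi * of_int m) = sin \<phi>" "cos (\<phi> + 2 * pi * of_int m) = cos \<phi>"
    using sin_int_2pin cos_int_2pin by (auto simp: sin_add cos_add)
qed

lemma rotation_multiple_mem:
  assumes J: "J ** J = - mat 1" and S: "\<And>X Y. X \<in> S \<Longrightarrow> Y \<in> S \<Longrightarrow> X ** Y \<in> S"
    and "rotation J \<theta> \<in> S" "n \<ge> 1"
  shows "rotation J (real n * \<theta>) \<in> S"
  using \<open>n \<ge> 1\<close>
proof (induction n rule: dec_induct)
  case base
  then show ?case using assms by simp
next
  case (step n)
  have "rotation J (real (Suc n) * \<theta>) = rotation J (real n * \<theta>) ** rotation J \<theta>"
    by (simp add: rotation_add[OF J] algebra_simps)
  then show ?case using step S assms by simp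
qed

text \<open>
  The angle is chosen between 0 and \<open>pi\<close>, where it depends continuously on the matrix and is
  determined by the trace; the sense of rotation is then part of the generator.
\<close>
definition rot_angle :: "real^2^2 \<Rightarrow> real" where
  "rot_angle E = arccos (trace E / 2)"

definition rot_gen :: "real^2^2 \<Rightarrow> real^2^2" where
  "rot_gen E = (E - cos (rot_angle E) *\<^sub>R mat 1) /\<^sub>R sin (rot_angle E)"

lemma elliptic_rotation:
  assumes "det E = 1" "\<bar>trace E\<bar> < 2"
  shows "rotation (rot_gen E) (rot_angle E) = E" "rot_gen E ** rot_gen E = - mat 1" "sin (rot_angle E) > 0"
proof -
  have c: "cos (rot_angle E) = trace E / 2" using assms(2) by (simp add: rot_angle_def)
  have s: "sin (rot_angle E) = sqrt (1 - (trace E / 2)\<^sup>2)"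
    using assms(2) by (simp add: rot_angle_def sin_arccos_abs)
  have "(trace E / 2)\<^sup>2 < 1" using assms(2) by (simp add: abs_square_less_1)
  then show s0: "sin (rot_angle E) > 0" by (simp add: s)
  then show "rotation (rot_gen E) (rot_angle E) = E" by (simp add: rotation_def rot_gen_def)
  define p where "p = sin (rot_angle E)"
  have p: "p * p = 1 - (trace E / 2)\<^sup>2" "p > 0"
    using s0 \<open>(trace E / 2)\<^sup>2 < 1\<close> by (simp_all add: p_def s)
  have q: "(E - (trace E / 2) *\<^sub>R mat 1) ** (E - (trace E / 2) *\<^sub>R mat 1) = - (p * p) *\<^sub>R mat 1"
    using assms(1) unfolding p mat2_simps by (simp add: power2_eq_square field_simps)
  have "rot_gen E ** rot_gen E = (inverse p * inverse p) *\<^sub>R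
      ((E - (trace E / 2) *\<^sub>R mat 1) ** (E - (trace E / 2) *\<^sub>R mat 1))"
    unfolding rot_gen_def c p_def[symmetric] by (simp add: mat2_eq_iff mat2_mult_nth algebra_simps)
  also have "\<dots> = - mat 1" unfolding q using p(2) by (simp add: mat2_eq_iff field_simps)
  finally show "rot_gen E ** rot_gen E = - mat 1" .
qed

lemma tendsto_matrix_mult2 [tendsto_intros]:
  fixes f g :: "'a \<Rightarrow> real^2^2"
  assumes "(f \<longlongrightarrow> a) F" "(g \<longlongrightarrow> b) F"
  shows "((\<lambda>x. f x ** g x) \<longlongrightarrow> a ** b) F"
  unfolding matrix_matrix_mult_def by (intro tendsto_intros assms)

lemma tendsto_trace2 [tendsto_intros]:
  fixes f :: "'a \<Rightarrow> real^2^2"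
  assumes "(f \<longlongrightarrow> a) F"
  shows "((\<lambda>x. trace (f x)) \<longlongrightarrow> trace a) F"
  unfolding trace2 by (intro tendsto_intros assms)

text \<open>
  If the angles \<open>d n\<close> tend to 0, then every angle is, up to full turns, a limit of positive multiples of
  them. Only positive multiples are available in a semigroup, so \<open>\<phi>\<close> is first shifted by full turns
  to a number \<open>\<psi> n\<close> that has the same sign as \<open>d n\<close>.
\<close>
lemma small_rotations_fill_circle:
  fixes J :: "nat \<Rightarrow> real^2^2"
  assumes S: "\<And>X Y. X \<in> S \<Longrightarrow> Y \<in> S \<Longrightarrow> X ** Y \<in> S"
    and J: "\<And>n. J n ** J n = - mat 1" "J \<longlonglongrightarrow> L"
    and d: "d \<longlonglongrightarrow> 0" "\<And>n. d n \<noteq> 0"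
    and mem: "\<And>n. rotation (J n) (d n) \<in> S"
  shows "rotation L \<phi> \<in> closure S"
proof -
  obtain m :: nat where m: "\<bar>\<phi>\<bar> < real m * (2 * pi)"
    using reals_Archimedean3[of "2 * pi"] by auto
  define \<psi> where "\<psi> n = \<phi> + 2 * pi * of_int (if d n > 0 then int m else - int m)" for n
  have sgn: "\<psi> n / d n > 0" for n
    using d(2)[of n] m by (cases "d n > 0") (auto simp: \<psi>_def field_simps zero_less_divide_iff)
  define k where "k n = nat \<lceil>\<psi> n / d n\<rceil>" for n
  have k1: "k n \<ge> 1" for n using sgn[of n] by (simp add: k_def Suc_le_eq)
  have kr: "real (k n) = of_int \<lceil>\<psi> n / d n\<rceil>" for n
    using sgn[of n] by (simp add: k_def ceiling_mono)
  define e where "e n = real (k n) * d n - \<psi> n" for n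
  have e: "\<bar>e n\<bar> \<le> \<bar>d n\<bar>" for n
  proof -
    have "\<bar>e n\<bar> = \<bar>real (k n) - \<psi> n / d n\<bar> * \<bar>d n\<bar>"
      using d(2)[of n] by (simp add: e_def abs_mult[symmetric] left_diff_distrib)
    also have "\<dots> \<le> 1 * \<bar>d n\<bar>"
      unfolding kr by (intro mult_right_mono) linarith+
    finally show ?thesis by simp
  qed
  have "e \<longlonglongrightarrow> 0"
    by (rule Lim_null_comparison[OF _ tendsto_rabs_zero[OF d(1)]]) (use e in auto)
  then have "(\<lambda>n. rotation (J n) (e n + \<phi>)) \<longlonglongrightarrow> rotation L (0 + \<phi>)"
    unfolding rotation_def by (intro tendsto_intros J)
  moreover have "rotation (J n) (e n + \<phi>) \<in> S" for n
  proof -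
    have "rotation (J n) (real (k n) * d n) \<in> S"
      by (rule rotation_multiple_mem[OF J(1) S mem k1])
    also have "real (k n) * d n = (e n + \<phi>) + 2 * pi * of_int (if d n > 0 then int m else - int m)"
      by (simp add: e_def \<psi>_def)
    finally show ?thesis by (simp only: rotation_plus_2pi)
  qed
  ultimately show ?thesis
    unfolding closure_sequential by (intro exI[of _ "\<lambda>n. rotation (J n) (e n + \<phi>)"]) simp
qed

text \<open>By Dirichlet's theorem some positive multiples of the angle come arbitrarily close to full turns,
  and by irrationality none of them is a full turn.\<close>
lemma irrational_rotation_fills_circle:
  assumes S: "\<And>X Y. X \<in> S \<Longrightarrow> Y \<in> S \<Longrightarrow> X ** Y \<in> S"
    and J: "J ** J = - mat 1" and mem: "rotation J \<theta> \<in> S"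
    and irr: "\<And>n::nat. \<And>m::int. n \<ge> 1 \<Longrightarrow> real n * \<theta> \<noteq> 2 * pi * of_int m"
  shows "rotation J \<phi> \<in> closure S"
proof -
  have "\<exists>k h. k \<ge> (1::nat) \<and> \<bar>real k * \<theta> - 2 * pi * of_int h\<bar> < 2 * pi / Suc n" for n
  proof -
    obtain h k where hk: "0 < k" "k \<le> int (Suc n)" "\<bar>of_int k * (\<theta> / (2 * pi)) - of_int h\<bar> < 1 / real (Suc n)"
      using Dirichlet_approx[of "Suc n"] by blast
    have "\<bar>real (nat k) * \<theta> - 2 * pi * of_int h\<bar> = \<bar>of_int k * (\<theta> / (2 * pi)) - of_int h\<bar> * (2 * pi)"
      using hk(1) by (simp add: abs_mult[symmetric] field_simps)
    also have "\<dots> < 1 / real (Suc n) * (2 * pi)"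
      by (intro mult_strict_right_mono hk) simp
    finally have "\<bar>real (nat k) * \<theta> - 2 * pi * of_int h\<bar> < 2 * pi / Suc n" by simp
    moreover have "nat k \<ge> 1" using hk by simp
    ultimately show ?thesis by blast
  qed
  then obtain k h where kh: "\<And>n. k n \<ge> (1::nat)" "\<And>n. \<bar>real (k n) * \<theta> - 2 * pi * of_int (h n)\<bar> < 2 * pi / Suc n"
    by metis
  define d where "d n = real (k n) * \<theta> - 2 * pi * of_int (h n)" for n
  show ?thesis
  proof (rule small_rotations_fill_circle[where J = "\<lambda>_. J" and d = d])
    have "(\<lambda>n. 2 * pi / Suc n) \<longlonglongrightarrow> 0"
      using tendsto_mult_right_zero[OF LIMSEQ_inverse_real_of_nat, of "2 * pi"] by (simp add: divide_inverse)
    then show "d \<longlonglongrightarrow> 0"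
      by (rule Lim_null_comparison[rotated]) (use kh(2) in \<open>auto simp: d_def less_imp_le\<close>)
    show "d n \<noteq> 0" for n using irr kh(1) by (simp add: d_def)
    show "rotation J (d n) \<in> S" for n
    proof -
      have "rotation J (real (k n) * \<theta>) \<in> S" by (rule rotation_multiple_mem[OF J S mem kh(1)])
      also have "real (k n) * \<theta> = d n + 2 * pi * of_int (h n)" by (simp add: d_def)
      finally show ?thesis by (simp only: rotation_plus_2pi)
    qed
  qed (use S J in auto)
qed

section \<open>A circle group and a hyperbolic matrix generate SL(2,R)\<close>

text \<open>
  The matrix of the real linear map \<open>w \<mapsto> \<alpha> * w + \<beta> * cnj w\<close> of the complex plane. In these
  coordinates, multiplication by rotations on the two sides changes the arguments of \<open>\<alpha>\<close> and \<open>\<beta>\<close>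
  independently, and on SL(2,R) the modulus of \<open>\<alpha>\<close> determines that of \<open>\<beta>\<close>.
\<close>
definition cmat :: "complex \<Rightarrow> complex \<Rightarrow> real^2^2" where
  "cmat \<alpha> \<beta> = vector [vector [Re \<alpha> + Re \<beta>, Im \<beta> - Im \<alpha>], vector [Im \<alpha> + Im \<beta>, Re \<alpha> - Re \<beta>]]"

lemma cmat_nth [simp]:
  "cmat \<alpha> \<beta> $1$1 = Re \<alpha> + Re \<beta>" "cmat \<alpha> \<beta> $1$2 = Im \<beta> - Im \<alpha>"
  "cmat \<alpha> \<beta> $2$1 = Im \<alpha> + Im \<beta>" "cmat \<alpha> \<beta> $2$2 = Re \<alpha> - Re \<beta>"
  by (simp_all add: cmat_def)

lemma cmat_surj: obtains \<alpha> \<beta> where "A = cmat \<alpha> \<beta>"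
proof
  show "A = cmat (Complex ((A$1$1 + A$2$2) / 2) ((A$2$1 - A$1$2) / 2))
                 (Complex ((A$1$1 - A$2$2) / 2) ((A$2$1 + A$1$2) / 2))"
    by (simp add: mat2_eq_iff field_simps)
qed

lemma cmat_mult: "cmat \<alpha> \<beta> ** cmat \<gamma> \<delta> = cmat (\<alpha> * \<gamma> + \<beta> * cnj \<delta>) (\<alpha> * \<delta> + \<beta> * cnj \<gamma>)"
  by (simp add: mat2_simps algebra_simps)

lemma det_cmat: "det (cmat \<alpha> \<beta>) = (cmod \<alpha>)\<^sup>2 - (cmod \<beta>)\<^sup>2"
  by (simp add: det_2 cmod_power2) (simp add: power2_eq_square algebra_simps)

lemma equal_cmod_cis:
  assumes "cmod z = cmod w"
  obtains t where "w = z * cis t"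
proof
  have "w = rcis (cmod w) (Arg w)" "z = rcis (cmod z) (Arg z)" by (simp_all add: rcis_cmod_Arg)
  then show "w = z * cis (Arg w - Arg z)"
    by (metis assms add.commute cis_mult diff_add_cancel mult.assoc rcis_def)
qed

text \<open>
  By the above, membership of \<open>cmat \<alpha> \<beta>\<close> in \<open>S\<close> depends on \<open>cmod \<alpha>\<close> only. If \<open>r\<close> is such a modulus and
  \<open>q\<^sup>2 = r\<^sup>2 - 1\<close>, then a product of two elements with this modulus can have the modulus
  \<open>cmod (r\<^sup>2 + q\<^sup>2 * cis t)\<close> for any \<open>t\<close>, which takes every value from \<open>r\<^sup>2 - q\<^sup>2 = 1\<close> to \<open>r\<^sup>2 + q\<^sup>2 = 2 * r\<^sup>2 - 1\<close>.
  A hyperbolic matrix has modulus above 1, and iteration reaches all moduli.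
\<close>
lemma circle_and_hyperbolic_generate:
  assumes S: "\<And>X Y. X \<in> S \<Longrightarrow> Y \<in> S \<Longrightarrow> X ** Y \<in> S"
    and rot: "\<And>t. cmat (cis t) 0 \<in> S"
    and A: "A \<in> S" "det A = 1" "\<bar>trace A\<bar> > 2"
  shows "{X. det X = 1} \<subseteq> S"
proof -
  have turn: "cmat \<alpha>' \<beta>' \<in> S" if mem: "cmat \<alpha> \<beta> \<in> S" and eq: "cmod \<alpha> = cmod \<alpha>'" "cmod \<beta> = cmod \<beta>'" for \<alpha> \<beta> \<alpha>' \<beta>'
  proof -
    obtain s where s: "\<alpha>' = \<alpha> * cis s" using equal_cmod_cis[OF eq(1)] .
    obtain t where t: "\<beta>' = \<beta> * cis t" using equal_cmod_cis[OF eq(2)] .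
    have "cmat (cis ((s + t) / 2)) 0 ** cmat \<alpha> \<beta> ** cmat (cis ((s - t) / 2)) 0
        = cmat (\<alpha> * (cis ((s + t) / 2) * cis ((s - t) / 2))) (\<beta> * (cis ((s + t) / 2) * cis (- ((s - t) / 2))))"
      by (simp add: cmat_mult cis_cnj algebra_simps)
    also have "\<dots> = cmat \<alpha>' \<beta>'"
      unfolding cis_mult s t by (simp add: field_simps)
    finally show ?thesis using S[OF S[OF rot mem] rot] by metis
  qed
  define good where "good r \<longleftrightarrow> (\<exists>\<alpha> \<beta>. cmat \<alpha> \<beta> \<in> S \<and> det (cmat \<alpha> \<beta>) = 1 \<and> cmod \<alpha> = r)" for r
  have grow: "good r'" if "good r" "1 \<le> r'" "r' \<le> 2 * r\<^sup>2 - 1" for r r'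
  proof -
    obtain \<alpha> \<beta> where ab: "cmat \<alpha> \<beta> \<in> S" "(cmod \<alpha>)\<^sup>2 - (cmod \<beta>)\<^sup>2 = 1" "cmod \<alpha> = r"
      using \<open>good r\<close> unfolding good_def det_cmat by blast
    define q where "q = cmod \<beta>"
    have rq: "r\<^sup>2 - q\<^sup>2 = 1" "r \<ge> 0" "q \<ge> 0" using ab by (auto simp: q_def)
    let ?f = "\<lambda>t. cmod (of_real (r * r) + of_real (q * q) * cis t)"
    have "\<exists>t\<ge>-pi. t \<le> 0 \<and> ?f t = r'"
    proof (rule IVT')
      have "of_real (r * r) + of_real (q * q) * cis (- pi) = of_real (r\<^sup>2 - q\<^sup>2)"
        by (simp add: power2_eq_square complex_eq_iff)
      then show "?f (- pi) \<le> r'" using that rq by simp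
      have "of_real (r * r) + of_real (q * q) * cis 0 = of_real (r\<^sup>2 + q\<^sup>2)"
        by (simp add: power2_eq_square)
      then have "?f 0 = r\<^sup>2 + q\<^sup>2" by (simp only: norm_of_real) simp
      then show "r' \<le> ?f 0" using that rq by simp
      show "continuous_on {- pi..0} ?f" by (intro continuous_intros)
    qed simp
    then obtain t where t: "?f t = r'" by blast
    have "cmat (of_real r) (of_real q) \<in> S" "cmat (of_real r) (of_real q * cis (- t)) \<in> S"
      using rq ab by (auto intro!: turn[OF ab(1)] simp: norm_mult q_def)
    then have "cmat (of_real r) (of_real q) ** cmat (of_real r) (of_real q * cis (- t)) \<in> S" by (rule S)
    moreover have "det (cmat (of_real r) (of_real q) ** cmat (of_real r) (of_real q * cis (- t))) = 1"
      using rq by (simp add: det_mul det_cmat norm_mult)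
    ultimately show ?thesis
      using t unfolding cmat_mult good_def by (auto simp: cis_cnj mult.assoc intro!: exI)
  qed
  obtain \<alpha> \<beta> where A_eq: "A = cmat \<alpha> \<beta>" using cmat_surj .
  define d where "d = cmod \<alpha> - 1"
  have "\<bar>Re \<alpha>\<bar> > 1" using A(3) by (simp add: A_eq trace2)
  then have d: "d > 0" using abs_Re_le_cmod[of \<alpha>] by (simp add: d_def)
  have big: "good (1 + 4 ^ n * d)" for n
  proof (induction n)
    case 0
    then show ?case using A by (auto simp: good_def A_eq d_def)
  next
    case (Suc n)
    show ?case
      by (rule grow[OF Suc]) (use d in \<open>auto simp: power2_eq_square algebra_simps\<close>)
  qed
  have all: "good r" if "r \<ge> 1" for r
  proof -
    obtain n where "r / d < 4 ^ n" using real_arch_pow[of 4 "r / d"] by auto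
    then have n: "r \<le> 1 + 4 ^ n * d" using d by (simp add: field_simps)
    define N where "N = 1 + 4 ^ n * d"
    have N: "N \<ge> 1" "r \<le> N" using d n by (simp_all add: N_def)
    then have "N * 1 \<le> N * N" by (intro mult_left_mono) auto
    then have "r \<le> 2 * N\<^sup>2 - 1" using N unfolding power2_eq_square by linarith
    then show ?thesis using grow[OF big that] by (simp add: N_def)
  qed
  show ?thesis
  proof
    fix X :: "real^2^2" assume "X \<in> {X. det X = 1}"
    then have X: "det X = 1" by simp
    obtain \<gamma> \<delta> where X_eq: "X = cmat \<gamma> \<delta>" using cmat_surj .
    have n: "(cmod \<gamma>)\<^sup>2 = 1 + (cmod \<delta>)\<^sup>2" using X by (simp add: X_eq det_cmat)
    then have "1\<^sup>2 \<le> (cmod \<gamma>)\<^sup>2" by simp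
    then have "1 \<le> cmod \<gamma>" by (rule power2_le_imp_le) simp
    then obtain \<alpha>' \<beta>' where ab: "cmat \<alpha>' \<beta>' \<in> S" "det (cmat \<alpha>' \<beta>') = 1" "cmod \<alpha>' = cmod \<gamma>"
      using all unfolding good_def by blast
    then have "(cmod \<beta>')\<^sup>2 = (cmod \<delta>)\<^sup>2" using n by (simp add: det_cmat)
    then have "cmod \<beta>' = cmod \<delta>" by simp
    then show "X \<in> S" unfolding X_eq using turn ab by blast
  qed
qed

text \<open>
  An upper triangular \<open>P\<close> moves the fixed point of the standard rotations to that of \<open>J\<close>.
  The sign \<open>e\<close> is needed because \<open>J\<close> and \<open>- J\<close> are not conjugate in SL(2,R).
\<close>
lemma complex_structure_conjugate:
  fixes J :: "real^2^2"
  assumes "J ** J = - mat 1"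
  obtains P e where "det P = 1" "P ** cmat \<i> 0 ** adj2 P = e *\<^sub>R J" "e = 1 \<or> e = (-1::real)"
proof -
  define p q r where "p = J$1$1" and "q = J$1$2" and "r = J$2$1"
  have e: "p * p + q * r = -1" "q * (p + J$2$2) = 0" "r * (p + J$2$2) = 0"
    using assms by (auto simp: mat2_simps p_def q_def r_def algebra_simps)
  have "p * p \<ge> 0" by simp
  then have qr: "q * r \<le> -1" using e(1) by linarith
  then have r0: "r \<noteq> 0" by auto
  then have J22: "J$2$2 = - p" using e(3) by auto
  define \<epsilon> where "\<epsilon> = sgn r"
  define s where "s = 1 / sqrt \<bar>r\<bar>"
  have s: "s > 0" "s * s * \<bar>r\<bar> = 1" using r0 by (auto simp: s_def)
  define P :: "real^2^2" where "P = vector [vector [s, \<epsilon> * p * s], vector [0, 1 / s]]"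
  have P: "P$1$1 = s" "P$1$2 = \<epsilon> * p * s" "P$2$1 = 0" "P$2$2 = 1 / s"
    by (simp_all add: P_def)
  have ss: "1 / s * (1 / s) = \<epsilon> * r" using s r0 by (simp add: field_simps \<epsilon>_def abs_sgn)
  have ee: "\<epsilon> * \<epsilon> = 1" using r0 by (auto simp: \<epsilon>_def sgn_real_def)
  have qq: "- (s * s + \<epsilon> * p * s * (\<epsilon> * p * s)) = \<epsilon> * q"
  proof -
    have "s * s + \<epsilon> * p * s * (\<epsilon> * p * s) = s * s * (1 + p * p)" using ee by algebra
    also have "\<dots> = - (s * s * r) * q" using e(1) by algebra
    also have "s * s * r = \<epsilon>" using s(2) ee by (simp add: \<epsilon>_def abs_sgn) (metis \<epsilon>_def ee mult.assoc mult.commute mult.right_neutral)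
    finally show ?thesis by simp
  qed
  have "P ** cmat \<i> 0 ** adj2 P = \<epsilon> *\<^sub>R J"
    unfolding mat2_eq_iff mat2_mult_nth using s(1) ss qq
    by (simp add: P J22 p_def[symmetric] q_def[symmetric] r_def[symmetric])
  moreover have "det P = 1" using s by (simp add: det_2 P)
  moreover have "\<epsilon> = 1 \<or> \<epsilon> = -1" using r0 by (auto simp: \<epsilon>_def sgn_real_def)
  ultimately show thesis using that by blast
qed

lemma rotations_and_hyperbolic_generate:
  assumes S: "\<And>X Y. X \<in> S \<Longrightarrow> Y \<in> S \<Longrightarrow> X ** Y \<in> S"
    and J: "J ** J = - mat 1" and rot: "\<And>t. rotation J t \<in> S"
    and A: "A \<in> S" "det A = 1" "\<bar>trace A\<bar> > 2"
  shows "{X. det X = 1} \<subseteq> S"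
proof -
  obtain P e where P: "det P = 1" "P ** cmat \<i> 0 ** adj2 P = e *\<^sub>R J" "e = 1 \<or> e = (-1::real)"
    using complex_structure_conjugate[OF J] .
  note inv = adj2_inverse[OF P(1)]
  have cancel: "adj2 P ** (P ** X) = X" "P ** (adj2 P ** X) = X" for X
    by (simp_all add: inv matrix_mul_assoc)
  define T where "T = {X. P ** X ** adj2 P \<in> S}"
  have mul: "P ** (X ** Y) ** adj2 P = (P ** X ** adj2 P) ** (P ** Y ** adj2 P)" for X Y
    by (simp add: cancel flip: matrix_mul_assoc)
  have "{X. det X = 1} \<subseteq> T"
  proof (rule circle_and_hyperbolic_generate)
    show "X ** Y \<in> T" if "X \<in> T" "Y \<in> T" for X Y
      using that S by (simp add: T_def mul)
    show "cmat (cis t) 0 \<in> T" for t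
    proof -
      have "cmat (cis t) 0 = cos t *\<^sub>R mat 1 + sin t *\<^sub>R cmat \<i> 0" by (simp add: mat2_eq_iff)
      then have "P ** cmat (cis t) 0 ** adj2 P = cos t *\<^sub>R (P ** adj2 P) + sin t *\<^sub>R (P ** cmat \<i> 0 ** adj2 P)"
        by (simp add: mat2_eq_iff mat2_mult_nth algebra_simps)
      also have "\<dots> = rotation J (e * t)" using P(3) by (auto simp: inv P(2) rotation_def)
      finally show ?thesis using rot by (simp add: T_def)
    qed
    show "adj2 P ** A ** P \<in> T"
      using A by (simp add: T_def cancel inv flip: matrix_mul_assoc)
    show "det (adj2 P ** A ** P) = 1" by (simp add: det_mul P A)
    have "trace (adj2 P ** A ** P) = det P * trace A" by (simp add: mat2_simps algebra_simps)
    then show "\<bar>trace (adj2 P ** A ** P)\<bar> > 2" using A P by simp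
  qed
  moreover have "adj2 P ** X ** P \<in> {X. det X = 1}" if "det X = 1" for X
    using that by (simp add: det_mul P)
  ultimately have "adj2 P ** X ** P \<in> T" if "det X = 1" for X using that by blast
  then show ?thesis by (auto simp: T_def cancel inv simp flip: matrix_mul_assoc)
qed

section \<open>Nondiscrete groups\<close>

lemma trace_conj:
  assumes "det P = 1"
  shows "trace (adj2 P ** X ** P) = trace (X :: real^2^2)" "trace (P ** X ** adj2 P) = trace X"
proof -
  have "trace (adj2 P ** X ** P) = det P * trace X" "trace (P ** X ** adj2 P) = det P * trace X"
    by (simp_all add: mat2_simps algebra_simps)
  then show "trace (adj2 P ** X ** P) = trace X" "trace (P ** X ** adj2 P) = trace X"
    using assms by simp_all
qed

text \<open>The columns of \<open>P\<close> are eigenvectors, the first one rescaled to make the determinant 1.\<close>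
lemma hyperbolic_diagonalize:
  assumes "hyperbolic A"
  obtains P a where "det P = 1" "\<bar>a\<bar> > 1"
    "adj2 P ** A ** P = vector [vector [a, 0], vector [0, 1 / a]]"
proof -
  obtain v w a where *: "bracket v w \<noteq> 0" "\<bar>a\<bar> > 1" "A *v v = a *s v" "A *v w = (1 / a) *s w"
    using hyperbolic_eigenbasis[OF assms] by metis
  define m where "m = bracket v w"
  define P :: "real^2^2" where "P = vector [vector [v$1 / m, w$1], vector [v$2 / m, w$2]]"
  have P: "P$1$1 = v$1 / m" "P$1$2 = w$1" "P$2$1 = v$2 / m" "P$2$2 = w$2" by (simp_all add: P_def)
  have m: "v$1 * w$2 - v$2 * w$1 = m" "m \<noteq> 0" using *(1) by (simp_all add: m_def bracket_def)
  then have det: "det P = 1" by (simp add: det_2 P divide_simps) (simp add: algebra_simps)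
  have e: "A$1$1 * v$1 + A$1$2 * v$2 = a * v$1" "A$2$1 * v$1 + A$2$2 * v$2 = a * v$2"
    "A$1$1 * w$1 + A$1$2 * w$2 = 1 / a * w$1" "A$2$1 * w$1 + A$2$2 * w$2 = 1 / a * w$2"
    using *(3,4) by (auto simp: vec_eq_iff forall_2 matrix_vector_mult_def sum_2)
  let ?D = "vector [vector [a, 0], vector [0, 1 / a]] :: real^2^2"
  have "A ** P = P ** ?D"
    using m(2) e by (simp add: mat2_eq_iff mat2_mult_nth P) (simp add: field_simps)
  then have "adj2 P ** A ** P = adj2 P ** P ** ?D" by (simp flip: matrix_mul_assoc)
  then show thesis using that det *(2) by (simp add: adj2_inverse)
qed

text \<open>
  With \<open>b = a\<^sup>2\<close>, conjugation of \<open>R\<close> by \<open>D\<close> and its inverse multiplies the off-diagonal entries by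
  \<open>b\<close> and \<open>1 / b\<close>. The three trace conditions are then linear equations with an invertible
  (Vandermonde) matrix for the diagonal contribution \<open>s\<close> and the two off-diagonal ones \<open>p\<close>, \<open>q\<close>.
\<close>
lemma diagonal_trace_rigidity:
  fixes D R g :: "real^2^2"
  assumes D: "D = vector [vector [a, 0], vector [0, 1 / a]]" "\<bar>a\<bar> > 1"
    and R: "R$1$2 * R$2$1 \<noteq> 0"
    and tr: "trace (R ** g) = trace R" "trace (D ** R ** adj2 D ** g) = trace R"
      "trace (adj2 D ** R ** D ** g) = trace R"
  shows "g$1$2 = 0" "g$2$1 = 0"
proof -
  have Dn: "D$1$1 = a" "D$1$2 = 0" "D$2$1 = 0" "D$2$2 = 1 / a" by (simp_all add: D)
  have a0: "a \<noteq> 0" using D by auto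
  define p q s where "p = R$1$2 * g$2$1" and "q = R$2$1 * g$1$2"
    and "s = R$1$1 * (g$1$1 - 1) + R$2$2 * (g$2$2 - 1)"
  define b where "b = a * a"
  have aa: "b > 1" using less_1_mult[of "\<bar>a\<bar>" "\<bar>a\<bar>"] D(2) by (simp add: b_def)
  have e1: "s + p + q = 0"
    using tr(1) by (simp add: p_def q_def s_def trace2 mat2_mult_nth algebra_simps)
  have "s + b * p + q / b = 0"
    using tr(2) a0 by (simp add: p_def q_def s_def b_def trace2 mat2_mult_nth Dn algebra_simps)
  then have e2: "b * s + b * b * p + q = 0" using aa by (simp add: field_simps)
  have "s + p / b + b * q = 0"
    using tr(3) a0 by (simp add: p_def q_def s_def b_def trace2 mat2_mult_nth Dn algebra_simps)
  then have e3: "b * s + p + b * b * q = 0" using aa by (simp add: field_simps)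
  have "(b - 1) * (b + 1) * (p - q) = 0" "(b - 1) * (b - 1) * (p + q) = 0"
    using e1 e2 e3 by algebra+
  then have "p = 0" "q = 0" using aa by auto
  then show "g$1$2 = 0" "g$2$1 = 0" using R by (auto simp: p_def q_def)
qed

definition test_conjugates :: "real^2^2 \<Rightarrow> real^2^2 \<Rightarrow> (real^2^2) set" where
  "test_conjugates A R = {R, A ** R ** adj2 A, adj2 A ** R ** A}"

text \<open>
  In a basis that diagonalizes \<open>A\<close>, the preceding lemma makes \<open>g\<close> and \<open>B ** g ** adj2 B\<close> diagonal.
  If \<open>g\<close> is not scalar, then \<open>B\<close> permutes the two coordinate axes: it is diagonal and commutes with
  \<open>A\<close>, or antidiagonal and has trace 0.
\<close>
lemma trace_rigidity:
  fixes A B R g :: "real^2^2"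
  assumes A: "hyperbolic A" and B: "det B = 1" "trace B \<noteq> 0" and AB: "A ** B \<noteq> B ** A"
    and R: "det R = 1" "\<bar>trace R\<bar> < 2" and g: "det g = 1"
    and tr: "\<And>h. h \<in> test_conjugates A R \<Longrightarrow> trace (h ** g) = trace R \<and> trace (h ** (B ** g ** adj2 B)) = trace R"
  shows "g = mat 1 \<or> g = - mat 1"
proof -
  obtain P a where P: "det P = 1" "\<bar>a\<bar> > 1" "adj2 P ** A ** P = vector [vector [a, 0], vector [0, 1 / a]]"
    using hyperbolic_diagonalize[OF A] .
  define c where "c X = adj2 P ** X ** P" for X
  have P2: "P ** (adj2 P ** X) = X" for X by (simp add: adj2_inverse[OF P(1)] matrix_mul_assoc)
  have cm: "c (X ** Y) = c X ** c Y" for X Y by (simp add: c_def P2 flip: matrix_mul_assoc)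
  have ca: "c (adj2 X) = adj2 (c X)" for X by (simp add: c_def adj2_mult matrix_mul_assoc)
  have ct: "trace (c X) = trace X" for X by (simp add: c_def trace_conj[OF P(1)])
  have cd: "det (c X) = det X" for X by (simp add: c_def det_mul P)
  have ci: "P ** c X ** adj2 P = X" for X
    by (simp add: c_def P2 adj2_inverse[OF P(1)] flip: matrix_mul_assoc)
  have cD: "c A = vector [vector [a, 0], vector [0, 1 / a]]" using P(3) by (simp add: c_def)
  \<comment> \<open>A triangular matrix of determinant 1 is not elliptic.\<close>
  have offR: "c R $1$2 * c R $2$1 \<noteq> 0"
  proof
    assume "c R $1$2 * c R $2$1 = 0"
    moreover have "det (c R) = 1" using cd R by simp
    ultimately have "c R $1$1 * c R $2$2 = 1" unfolding det_2 by linarith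
    moreover have "trace R = c R $1$1 + c R $2$2" by (metis ct trace2)
    ultimately have "(trace R)\<^sup>2 - 4 = (c R $1$1 - c R $2$2)\<^sup>2" by algebra
    then have "(trace R)\<^sup>2 - 4 \<ge> 0" by simp
    then have "2\<^sup>2 \<le> (trace R)\<^sup>2" by simp
    then show False using R(2) abs_le_square_iff[of 2 "trace R"] by simp
  qed
  have rigid: "c k $1$2 = 0" "c k $2$1 = 0" if "\<And>h. h \<in> test_conjugates A R \<Longrightarrow> trace (h ** k) = trace R" for k
  proof -
    have t: "trace (c h ** c k) = trace R" if "h \<in> test_conjugates A R" for h
      using that \<open>\<And>h. h \<in> test_conjugates A R \<Longrightarrow> trace (h ** k) = trace R\<close> by (simp add: ct flip: cm)
    show "c k $1$2 = 0" "c k $2$1 = 0"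
      using diagonal_trace_rigidity[OF cD P(2) offR, of "c k"]
        t[of R] t[of "A ** R ** adj2 A"] t[of "adj2 A ** R ** A"]
      by (simp_all add: test_conjugates_def cm ca ct)
  qed
  define d e where "d = c g $1$1" and "e = c g $2$2"
  define p q r s where "p = c B $1$1" and "q = c B $1$2" and "r = c B $2$1" and "s = c B $2$2"
  have g0: "c g $1$2 = 0" "c g $2$1 = 0" using rigid tr by auto
  have "c (B ** g ** adj2 B) $1$2 = 0" "c (B ** g ** adj2 B) $2$1 = 0" using rigid tr by auto
  then have off: "p * q * (e - d) = 0" "r * s * (e - d) = 0"
    by (auto simp: cm ca mat2_mult_nth g0 p_def q_def r_def s_def d_def e_def algebra_simps)
  have de: "d * e = 1" using cd[of g] g by (simp add: det_2 g0 d_def e_def)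
  have pqrs: "p * s - q * r = 1" "p + s \<noteq> 0"
    using cd[of B] ct[of B] B by (auto simp: det_2 trace2 p_def q_def r_def s_def)
  have nc: "q \<noteq> 0 \<or> r \<noteq> 0"
  proof (rule ccontr)
    assume "\<not> (q \<noteq> 0 \<or> r \<noteq> 0)"
    then have "c A ** c B = c B ** c A" by (simp add: cD mat2_eq_iff mat2_mult_nth q_def r_def)
    then have "c (A ** B) = c (B ** A)" by (simp add: cm)
    then show False using AB ci by metis
  qed
  have "e = d"
  proof (rule ccontr)
    assume "e \<noteq> d"
    then have "p = 0 \<or> q = 0" "r = 0 \<or> s = 0" using off by auto
    then show False using pqrs nc by auto
  qed
  then have "d = 1 \<or> d = -1" using de by (simp add: square_eq_1_iff)
  then have "c g = mat 1 \<or> c g = - mat 1"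
    using g0 \<open>e = d\<close> by (auto simp: mat2_eq_iff d_def e_def)
  moreover have "c (mat 1) = mat 1" by (simp add: c_def adj2_inverse[OF P(1)])
  moreover have "c (- mat 1) = - mat 1"
  proof -
    have "c (- mat 1) = - (adj2 P ** P)" by (simp add: c_def mat2_eq_iff mat2_mult_nth)
    then show ?thesis by (simp add: adj2_inverse[OF P(1)])
  qed
  ultimately have "c g = c (mat 1) \<or> c g = c (- mat 1)" by auto
  then show ?thesis using ci by metis
qed

lemma nondiscrete_group_accumulates_at_one:
  assumes S: "\<And>X Y. X \<in> S \<Longrightarrow> Y \<in> S \<Longrightarrow> X ** Y \<in> S" "\<And>X. X \<in> S \<Longrightarrow> adj2 X \<in> S"
    "\<And>X. X \<in> S \<Longrightarrow> det X = 1"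
    and "\<not> discrete S"
  obtains g where "\<And>n::nat. g n \<in> S" "\<And>n. g n \<noteq> mat 1" "g \<longlonglongrightarrow> mat 1"
proof -
  obtain x where "x \<in> S" "x islimpt S"
    using assms(4) by (auto simp: discrete_def isolated_in_islimpt_iff)
  then obtain f where f: "\<And>n::nat. f n \<in> S - {x}" "f \<longlonglongrightarrow> x"
    unfolding islimpt_sequential by blast
  note inv = adj2_inverse[OF S(3)[OF \<open>x \<in> S\<close>]]
  show thesis
  proof (rule that)
    show "adj2 x ** f n \<in> S" for n using S f \<open>x \<in> S\<close> by blast
    show "adj2 x ** f n \<noteq> mat 1" for n
    proof
      assume "adj2 x ** f n = mat 1"
      then have "x ** (adj2 x ** f n) = x" by simp
      then have "f n = x" by (simp add: matrix_mul_assoc inv)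
      then show False using f by blast
    qed
    have "(\<lambda>n. adj2 x ** f n) \<longlonglongrightarrow> adj2 x ** x" by (intro tendsto_intros f)
    then show "(\<lambda>n. adj2 x ** f n) \<longlonglongrightarrow> mat 1" by (simp add: inv)
  qed
qed

text \<open>
  By \<open>trace_rigidity\<close>, finitely many conjugates \<open>h\<close> of \<open>R\<close> suffice to detect every \<open>g\<close> close to 1 by
  the change of trace from \<open>h\<close> to \<open>h ** g\<close>. So one of them detects infinitely many members of a
  sequence that tends to 1. The \<open>N\<close>-th powers of the resulting elliptic elements
  are rotations by small nonzero angles about converging centres.
\<close>
lemma nondiscrete_group_contains_circle:
  fixes A B R :: "real^2^2"
  assumes S: "\<And>X Y. X \<in> S \<Longrightarrow> Y \<in> S \<Longrightarrow> X ** Y \<in> S" "\<And>X. X \<in> S \<Longrightarrow> adj2 X \<in> S"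
    "\<And>X. X \<in> S \<Longrightarrow> det X = 1"
    and nd: "\<not> discrete S" and mem: "A \<in> S" "B \<in> S" "R \<in> S"
    and A: "hyperbolic A" and B: "trace B \<noteq> 0" and AB: "A ** B \<noteq> B ** A"
    and R: "\<bar>trace R\<bar> < 2" and fin: "N \<ge> (1::nat)" "real N * rot_angle R = 2 * pi * of_int m"
  obtains J where "J ** J = - mat 1" "\<And>\<phi>. rotation J \<phi> \<in> closure S"
proof -
  obtain g where g: "\<And>n::nat. g n \<in> S" "\<And>n. g n \<noteq> mat 1" "g \<longlonglongrightarrow> mat 1"
    using nondiscrete_group_accumulates_at_one[OF S nd] by blast
  \<comment> \<open>The second half accounts for testing \<open>B ** g ** adj2 B\<close>, since the trace is invariant under
    cyclic permutation of a product.\<close>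
  define F where "F = test_conjugates A R \<union> (\<lambda>h. adj2 B ** h ** B) ` test_conjugates A R"
  have F: "h \<in> S" "trace h = trace R" if "h \<in> F" for h
    using that S(1,2) mem by (auto simp: F_def test_conjugates_def trace_conj S(3))
  have "finite F" by (simp add: F_def test_conjugates_def)
  have "\<exists>h\<in>F. \<exists>\<^sub>F n in sequentially. trace (h ** g n) \<noteq> trace R"
  proof (rule ccontr)
    assume "\<not> ?thesis"
    then have "\<forall>\<^sub>F n in sequentially. \<forall>h\<in>F. trace (h ** g n) = trace R"
      using \<open>finite F\<close> by (simp add: eventually_ball_finite_distrib frequently_def)
    moreover have "\<forall>\<^sub>F n in sequentially. g n \<noteq> - mat 1"
    proof (rule tendsto_imp_eventually_ne[OF g(3)])
      show "mat 1 \<noteq> (- mat 1 :: real^2^2)" by (simp add: mat2_eq_iff)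
    qed
    ultimately have "\<forall>\<^sub>F n in sequentially. False"
    proof eventually_elim
      case (elim n)
      have "g n = mat 1 \<or> g n = - mat 1"
      proof (rule trace_rigidity[OF A S(3)[OF mem(2)] B AB S(3)[OF mem(3)] R S(3)[OF g(1)]])
        fix h assume h: "h \<in> test_conjugates A R"
        have "trace (h ** (B ** g n ** adj2 B)) = trace (adj2 B ** h ** B ** g n)"
          by (simp add: mat2_simps algebra_simps)
        then show "trace (h ** g n) = trace R \<and> trace (h ** (B ** g n ** adj2 B)) = trace R"
          using elim(1) h by (auto simp: F_def)
      qed
      then show ?case using elim(2) g(2) by blast
    qed
    then show False by simp
  qed
  then obtain h where h: "h \<in> F" and freq: "\<exists>\<^sub>F n in sequentially. trace (h ** g n) \<noteq> trace R" by blast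
  have lim: "(\<lambda>n. h ** g n) \<longlonglongrightarrow> h" using tendsto_matrix_mult2[OF tendsto_const g(3), of h] by simp
  have "\<forall>\<^sub>F n in sequentially. \<bar>trace (h ** g n)\<bar> < 2"
  proof (rule order_tendstoD)
    show "(\<lambda>n. \<bar>trace (h ** g n)\<bar>) \<longlonglongrightarrow> \<bar>trace h\<bar>" by (intro tendsto_intros lim)
    show "\<bar>trace h\<bar> < 2" using F h R by simp
  qed
  then have "\<exists>\<^sub>F n in sequentially. trace (h ** g n) \<noteq> trace R \<and> \<bar>trace (h ** g n)\<bar> < 2"
    by (rule frequently_rev_mp[OF freq eventually_mono]) simp
  then have "infinite {n. trace (h ** g n) \<noteq> trace R \<and> \<bar>trace (h ** g n)\<bar> < 2}"
    by (simp add: frequently_cofinite flip: cofinite_eq_sequentially)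
  then obtain \<rho> :: "nat \<Rightarrow> nat" where \<rho>: "strict_mono \<rho>"
    "\<And>n. trace (h ** g (\<rho> n)) \<noteq> trace R \<and> \<bar>trace (h ** g (\<rho> n))\<bar> < 2"
    using infinite_enumerate by (metis (mono_tags, lifting) mem_Collect_eq)
  define E where "E n = h ** g (\<rho> n)" for n
  have E: "E n \<in> S" "trace (E n) \<noteq> trace R" "\<bar>trace (E n)\<bar> < 2" "det (E n) = 1" for n
    using \<rho>(2) F(1)[OF h] g(1) S by (auto simp: E_def)
  have Elim: "E \<longlonglongrightarrow> h" using LIMSEQ_subseq_LIMSEQ[OF lim \<rho>(1)] by (simp add: E_def[abs_def] comp_def)
  have hh: "det h = 1" "\<bar>trace h\<bar> < 2" "rot_angle h = rot_angle R"
    using S(3) F[OF h] R by (auto simp: rot_angle_def)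
  note Erot = elliptic_rotation[OF E(4,3)] and hrot = elliptic_rotation[OF hh(1,2)]
  have angle: "(\<lambda>n. rot_angle (E n)) \<longlonglongrightarrow> rot_angle h"
    unfolding rot_angle_def
  proof (rule isCont_tendsto_compose[of _ arccos])
    show "isCont arccos (trace h / 2)" using hh(2) by (intro isCont_arccos) auto
    show "(\<lambda>n. trace (E n) / 2) \<longlonglongrightarrow> trace h / 2" by (intro tendsto_intros Elim) simp
  qed
  define d where "d n = real N * (rot_angle (E n) - rot_angle R)" for n
  have gen: "(\<lambda>n. rot_gen (E n)) \<longlonglongrightarrow> rot_gen h"
    unfolding rot_gen_def using hrot(3) by (intro tendsto_intros angle Elim) auto
  have "rotation (rot_gen h) \<phi> \<in> closure S" for \<phi>
  proof (rule small_rotations_fill_circle[where J = "\<lambda>n. rot_gen (E n)" and d = d])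
    have "d \<longlonglongrightarrow> real N * (rot_angle h - rot_angle R)"
      unfolding d_def by (intro tendsto_intros angle)
    then show "d \<longlonglongrightarrow> 0" by (simp add: hh(3))
    show "d n \<noteq> 0" for n
    proof
      assume "d n = 0"
      then have "arccos (trace (E n) / 2) = arccos (trace R / 2)" using fin(1) by (simp add: d_def rot_angle_def)
      then have "trace (E n) / 2 = trace R / 2" using E(3)[of n] R by (subst (asm) arccos_eq_iff) auto
      then show False using E(2) by simp
    qed
    show "rotation (rot_gen (E n)) (d n) \<in> S" for n
    proof -
      have "rotation (rot_gen (E n)) (real N * rot_angle (E n)) \<in> S"
        by (rule rotation_multiple_mem) (use S Erot E fin in auto)
      also have "real N * rot_angle (E n) = d n + 2 * pi * of_int m"
        unfolding fin(2)[symmetric] by (simp add: d_def algebra_simps)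
      finally show ?thesis by (simp only: rotation_plus_2pi)
    qed
  qed (use S Erot gen in auto)
  then show thesis using that hrot(2) by blast
qed

section \<open>The generated semigroup\<close>

lemma SL2_simps: "X \<in> carrier SL2 \<longleftrightarrow> det X = 1" "X \<otimes>\<^bsub>SL2\<^esub> Y = X ** Y" "\<one>\<^bsub>SL2\<^esub> = mat 1"
  by (simp_all add: SL2_def)

lemma group_SL2: "group SL2"
proof (rule groupI)
  show "\<exists>Y\<in>carrier SL2. Y \<otimes>\<^bsub>SL2\<^esub> X = \<one>\<^bsub>SL2\<^esub>" if "X \<in> carrier SL2" for X
    using that adj2_inverse by (auto simp: SL2_simps intro!: bexI[of _ "adj2 X"])
qed (auto simp: SL2_simps det_mul matrix_mul_assoc)

lemma inv_SL2: "det X = 1 \<Longrightarrow> inv\<^bsub>SL2\<^esub> X = adj2 X"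
  using group.inv_equality[OF group_SL2, of "adj2 X" X] adj2_inverse[of X] by (simp add: SL2_simps)

lemma foldr_mult_append:
  fixes Ms Ns :: "(real^2^2) list"
  shows "foldr (**) (Ms @ Ns) (mat 1) = foldr (**) Ms (mat 1) ** foldr (**) Ns (mat 1)"
  by (induction Ms) (auto simp: matrix_mul_assoc)

lemma closure_mult_closed:
  fixes S :: "(real^2^2) set"
  assumes S: "\<And>X Y. X \<in> S \<Longrightarrow> Y \<in> S \<Longrightarrow> X ** Y \<in> S"
    and "X \<in> closure S" "Y \<in> closure S"
  shows "X ** Y \<in> closure S"
proof -
  obtain f where f: "\<forall>n. f n \<in> S" "f \<longlonglongrightarrow> X" using assms(2) unfolding closure_sequential by blast
  obtain g where g: "\<forall>n. g n \<in> S" "g \<longlonglongrightarrow> Y" using assms(3) unfolding closure_sequential by blast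
  have "(\<lambda>n. f n ** g n) \<longlonglongrightarrow> X ** Y" by (intro tendsto_intros f g)
  then show ?thesis unfolding closure_sequential
    by (intro exI[of _ "\<lambda>n. f n ** g n"]) (use f g S in simp)
qed

lemma generated_semigroup_incl: "X \<in> G \<Longrightarrow> X \<in> generated_semigroup G"
  unfolding generated_semigroup_def by (auto intro!: exI[of _ "[X]"])

lemma generated_semigroup_mult:
  assumes "X \<in> generated_semigroup G" "Y \<in> generated_semigroup G"
  shows "X ** Y \<in> generated_semigroup G"
proof -
  obtain Ms Ns where *: "X = foldr (**) Ms (mat 1)" "Ms \<noteq> []" "set Ms \<subseteq> G"
    "Y = foldr (**) Ns (mat 1)" "set Ns \<subseteq> G"
    using assms unfolding generated_semigroup_def by blast
  then show ?thesis unfolding generated_semigroup_def mem_Collect_eq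
    by (intro exI[of _ "Ms @ Ns"]) (simp add: foldr_mult_append del: foldr_append)
qed

lemma generated_semigroup_induct [consumes 1, case_names incl mult]:
  assumes "X \<in> generated_semigroup G"
    and "\<And>X. X \<in> G \<Longrightarrow> P X"
    and "\<And>X Y. X \<in> G \<Longrightarrow> Y \<in> generated_semigroup G \<Longrightarrow> P Y \<Longrightarrow> P (X ** Y)"
  shows "P X"
proof -
  have "P (foldr (**) Ms (mat 1))" if "Ms \<noteq> []" "set Ms \<subseteq> G" for Ms
    using that
  proof (induction Ms rule: list_nonempty_induct)
    case (single X)
    then show ?case using assms(2) by simp
  next
    case (cons X Ms)
    then have "foldr (**) Ms (mat 1) \<in> generated_semigroup G" by (auto simp: generated_semigroup_def)
    then show ?case using cons assms(3) by simp
  qed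
  then show ?thesis using assms(1) unfolding generated_semigroup_def by blast
qed

text \<open>
  For arbitrary matrices of determinant 1 the left-hand side is the trace of the commutator plus 2.
\<close>
lemma commuting_traces:
  fixes A B :: "real^2^2"
  assumes "det A = 1" "det B = 1" "A ** B = B ** A"
  shows "(trace A)\<^sup>2 + (trace B)\<^sup>2 + (trace (A ** B))\<^sup>2 - trace A * trace B * trace (A ** B) = 4"
proof -
  have "(trace A)\<^sup>2 * det B + (trace B)\<^sup>2 * det A + (trace (A ** B))\<^sup>2 - trace A * trace B * trace (A ** B)
      = 2 * det A * det B + trace (A ** B ** adj2 (B ** A))"
    by (simp add: mat2_simps power2_eq_square algebra_simps)
  also have "trace (A ** B ** adj2 (B ** A)) = 2"
    using assms adj2_inverse[of "A ** B"] by (simp add: trace2 det_mul)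
  finally show ?thesis using assms by simp
qed

theorem theorem1p3:
  fixes A B :: "real^2^2"
  assumes "hyperbolic A" and "hyperbolic B"
    and "cross_ratio_defined A B"
    and "cross_ratio A B > 1"
    and "max (1/2 * \<bar>trace A\<bar>) (1/2 * \<bar>trace B\<bar>) \<le>
           (5 * cross_ratio A B - 1) / (3 * cross_ratio A B + 1)"
  shows "(subgroup (generated_semigroup {A, B}) SL2 \<and> discrete (generated_semigroup {A, B})) \<or>
         carrier SL2 \<subseteq> closure (generated_semigroup {A, B})"
proof -
  define S where "S = generated_semigroup {A, B}"
  define \<sigma> \<tau> where "\<sigma> = sgn (trace A)" and "\<tau> = sgn (trace B)"
  define x y z where "x = \<sigma> * trace A / 2" and "y = \<tau> * trace B / 2" and "z = \<sigma> * \<tau> * trace (A ** B) / 2"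
  have det: "det A = 1" "det B = 1" and tA: "\<bar>trace A\<bar> > 2" and tB: "trace B \<noteq> 0"
    using assms(1,2) by (auto simp: hyperbolic_def SL2_def)
  note S_mult = generated_semigroup_mult[of _ "{A, B}", folded S_def]
  have mem: "A \<in> S" "B \<in> S" by (simp_all add: S_def generated_semigroup_incl)
  have S_det: "det X = 1" if "X \<in> S" for X
    using that unfolding S_def by (induction rule: generated_semigroup_induct) (auto simp: det det_mul)
  note xyz = trace_data[OF assms x_def[unfolded \<sigma>_def] y_def[unfolded \<tau>_def] z_def[unfolded \<sigma>_def \<tau>_def]]
  define c where "c = sqrt (x\<^sup>2 + y\<^sup>2 + z\<^sup>2 - 2 * x * y * z - 1)"
  have c: "c > 0" "x\<^sup>2 + y\<^sup>2 + z\<^sup>2 - 2 * x * y * z - 1 = c\<^sup>2" using xyz(5) by (simp_all add: c_def)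
  have signs: "\<sigma>\<^sup>2 = 1" "\<tau>\<^sup>2 = 1" using tA tB by (auto simp: \<sigma>_def \<tau>_def sgn_real_def)
  have AB: "A ** B \<noteq> B ** A"
  proof
    assume "A ** B = B ** A"
    note * = commuting_traces[OF det this]
    have sq: "x\<^sup>2 = (trace A)\<^sup>2 / 4" "y\<^sup>2 = (trace B)\<^sup>2 / 4" "z\<^sup>2 = (trace (A ** B))\<^sup>2 / 4"
      by (simp_all add: x_def y_def z_def power_divide power_mult_distrib signs)
    have "x * y * z = \<sigma>\<^sup>2 * \<tau>\<^sup>2 * (trace A * trace B * trace (A ** B)) / 8"
      by (simp add: x_def y_def z_def power2_eq_square)
    then have "x\<^sup>2 + y\<^sup>2 + z\<^sup>2 - 2 * (x * y * z) - 1 = 0" using * unfolding sq signs by simp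
    then show False using xyz(5) by (simp add: mult.assoc)
  qed
  \<comment> \<open>Since \<open>x\<close> and \<open>y\<close> are below 3, this many steps suffice for the descent.\<close>
  obtain n :: nat where n: "3 < real n * c" using c(1) reals_Archimedean3 by blast
  obtain A' B' where AB': "A' \<in> S" "B' \<in> S" "\<bar>trace (A' ** B')\<bar> < 2"
    "adj2 A' \<in> S \<Longrightarrow> adj2 B' \<in> S \<Longrightarrow> adj2 A \<in> S \<and> adj2 B \<in> S"
    using elliptic_product_descent[OF S_mult mem det signs x_def y_def z_def c, of n] xyz n by force
  define R where "R = A' ** B'"
  have R: "R \<in> S" "\<bar>trace R\<bar> < 2" using AB' S_mult by (auto simp: R_def)
  note rot = elliptic_rotation[OF S_det[OF R(1)] R(2)]
  have dense: "carrier SL2 \<subseteq> closure S" if "J ** J = - mat 1" "\<And>\<phi>. rotation J \<phi> \<in> closure S" for J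
    using rotations_and_hyperbolic_generate[OF closure_mult_closed[OF S_mult] that _ det(1) tA] mem(1) closure_subset[of S]
    by (auto simp: SL2_def)
  show ?thesis
  proof (cases "\<exists>N m. N \<ge> (1::nat) \<and> real N * rot_angle R = 2 * pi * of_int m")
    case False
    have "rotation (rot_gen R) \<phi> \<in> closure S" for \<phi>
      by (rule irrational_rotation_fills_circle[OF S_mult rot(2), of "rot_angle R"]) (use rot R False in auto)
    then show ?thesis using dense[OF rot(2)] by (simp add: S_def)
  next
    case True
    then obtain N m where N: "N \<ge> (1::nat)" "real N * rot_angle R = 2 * pi * of_int m" by blast
    \<comment> \<open>\<open>Q\<close> is the inverse of \<open>R\<close>. It is the power with exponent \<open>2 * N - 1\<close>, as \<open>N - 1\<close> may be 0 and
      only positive powers are known to be in \<open>S\<close>.\<close>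
    define Q where "Q = rotation (rot_gen R) (real (2 * N - 1) * rot_angle R)"
    have Q: "Q \<in> S" unfolding Q_def by (rule rotation_multiple_mem[OF rot(2) S_mult]) (use rot R N in auto)
    have full: "real (2 * N - 1) * rot_angle R + rot_angle R = 0 + 2 * pi * of_int (2 * m)"
      using N by (simp add: of_nat_diff algebra_simps)
    have "Q ** R = mat 1" "R ** Q = mat 1"
    proof -
      have "Q ** R = rotation (rot_gen R) (real (2 * N - 1) * rot_angle R + rot_angle R)"
        "R ** Q = rotation (rot_gen R) (rot_angle R + real (2 * N - 1) * rot_angle R)"
        unfolding Q_def by (metis rot(1) rotation_add[OF rot(2)])+
      then show "Q ** R = mat 1" "R ** Q = mat 1"
        unfolding add.commute[of "rot_angle R"] full rotation_plus_2pi by (simp_all add: rotation_def)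
    qed
    note QR = this
    have "adj2 A' = B' ** Q"
    proof -
      have "adj2 A' = adj2 A' ** (R ** Q)" by (simp add: QR)
      also have "\<dots> = adj2 A' ** A' ** B' ** Q" by (simp add: R_def matrix_mul_assoc)
      finally show ?thesis using adj2_inverse[OF S_det[OF AB'(1)]] by simp
    qed
    moreover have "adj2 B' = Q ** A'"
    proof -
      have "adj2 B' = (Q ** R) ** adj2 B'" by (simp add: QR)
      also have "\<dots> = Q ** A' ** (B' ** adj2 B')" by (simp add: R_def matrix_mul_assoc)
      finally show ?thesis using adj2_inverse[OF S_det[OF AB'(2)]] by simp
    qed
    ultimately have adj: "adj2 A \<in> S" "adj2 B \<in> S" using AB' S_mult Q by auto
    have S_adj: "adj2 X \<in> S" if "X \<in> S" for X
      using that[unfolded S_def]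
      by (induction rule: generated_semigroup_induct) (use adj S_mult in \<open>auto simp: adj2_mult\<close>)
    have one: "mat 1 \<in> S" using S_mult[OF Q R(1)] QR by simp
    have "subgroup S SL2"
      by (rule subgroup.intro) (use S_mult S_det S_adj one in \<open>auto simp: SL2_simps inv_SL2\<close>)
    moreover have "carrier SL2 \<subseteq> closure S" if nd: "\<not> discrete S"
    proof -
      obtain J where "J ** J = - mat 1" "\<And>\<phi>. rotation J \<phi> \<in> closure S"
        using nondiscrete_group_contains_circle[OF S_mult S_adj S_det nd mem R(1) assms(1) tB AB R(2) N] by blast
      then show ?thesis using dense by blast
    qed
    ultimately show ?thesis by (auto simp: S_def)
  qed
qed

end
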